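(* Let $n\ge 1$, let $f:\{0,1\}^n\to\{0,1\}$ be an increasing boolean function, and let $0<p\le 1/2$. For every $\epsilon,\delta>0$, setting $k=\exp\big(10^{12}\lceil I_f(p)\rceil^2(\delta\epsilon)^{-2}\big)$, one has $$\mu_p\big(\{x: f(x)=1\}\setminus B_{\delta,k}\big)\le \epsilon .$$
   Context: $[n]=\{1,\dots,n\}$. $\mu_p$ is the product measure on $\{0,1\}^n$ with $\mu_p(\{x\})=p^{\sum_i x_i}(1-p)^{n-\sum_i x_i}$, and $\mathbb{E}_p$ is the corresponding expectation. $f$ is increasing if $x_i\ge y_i$ for all $i$ implies $f(x)\ge f(y)$. The total influence is $I_f(p)=\sum_{i\in[n]}\mathbb{P}(f(X)\ne f(X_{\{i\}}))$, where $X\sim\mu_p$ and $X_{\{i\}}$ is the same as $X$ except that its $i$-th component is replaced by an independent copy of $X_i$. A subset $S\subset[n]$ is a $(1-\delta)$-boosting set if $\mathbb{E}_p[f(x)\mid x_S=(1,\dots,1)]\ge 1-\delta$, where $x_S=(x_i)_{i\in S}$ (for $S=\varnothing$ the conditioning is void). $B_{\delta,k}$ is the event (set of $x\in\{0,1\}^n$) that $\{i\in[n]:x_i=1\}$ contains a $(1-\delta)$-boosting set of cardinality at most $k$. *)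

theory Defs
  imports "HOL-Probability.Probability" "HOL-Probability.Product_PMF"
begin

text \<open>
  The discrete cube \<open>{0,1}\<^sup>n\<close>, with coordinates indexed by \<open>{1..n}\<close> and \<open>True\<close> in the role of \<open>1\<close>.
  Points are functions that take the default value \<open>False\<close> outside \<open>{1..n}\<close>, so that every
  element of the cube is represented by exactly one function.
\<close>

definition cube :: "nat \<Rightarrow> (nat \<Rightarrow> bool) set" where
  "cube n = PiE_dflt {1..n} False (\<lambda>_. UNIV)"

definition mu :: "nat \<Rightarrow> real \<Rightarrow> (nat \<Rightarrow> bool) pmf" where
  "mu n p = Pi_pmf {1..n} False (\<lambda>_. bernoulli_pmf p)"

lemma set_mu_subset_cube: "set_pmf (mu n p) \<subseteq> cube n"
  unfolding mu_def cube_def by (auto simp: set_Pi_pmf PiE_dflt_def)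

lemma pmf_mu:
  assumes "x \<in> cube n" "0 \<le> p" "p \<le> 1"
  shows "pmf (mu n p) x =
    p ^ (\<Sum>i\<in>{1..n}. of_bool (x i)) * (1 - p) ^ (n - (\<Sum>i\<in>{1..n}. of_bool (x i)))"
proof -
  let ?A = "{i \<in> {1..n}. x i}"
  have s: "(\<Sum>i\<in>{1..n}. of_bool (x i)) = card ?A"
    by (simp add: of_bool_def sum.If_cases Int_def conj_commute)
  have c: "card {i \<in> {1..n}. \<not> x i} = n - card ?A"
  proof -
    have "{i \<in> {1..n}. \<not> x i} = {1..n} - ?A" by auto
    moreover have "card ({1..n} - ?A) = card {1..n} - card ?A"
      by (rule card_Diff_subset) auto
    ultimately show ?thesis by (simp only: card_atLeastAtMost diff_Suc_1)
  qed
  have "pmf (mu n p) x = (\<Prod>i\<in>{1..n}. pmf (bernoulli_pmf p) (x i))"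
    unfolding mu_def by (rule pmf_Pi') (use assms(1) in \<open>auto simp: cube_def PiE_dflt_def\<close>)
  also have "\<dots> = (\<Prod>i\<in>{1..n}. if x i then p else 1 - p)"
    using assms by (intro prod.cong) auto
  also have "\<dots> = p ^ card ?A * (1 - p) ^ card {i \<in> {1..n}. \<not> x i}"
    by (simp add: prod.If_cases Int_def conj_commute)
  finally show ?thesis by (simp only: s c)
qed

definition increasing_on_cube :: "nat \<Rightarrow> ((nat \<Rightarrow> bool) \<Rightarrow> bool) \<Rightarrow> bool" where
  "increasing_on_cube n f \<longleftrightarrow>
     (\<forall>x\<in>cube n. \<forall>y\<in>cube n. (\<forall>i\<in>{1..n}. x i \<ge> y i) \<longrightarrow> f x \<ge> f y)"

text \<open>
  In each summand the second component \<open>b\<close> of the pair is the independent copy of \<open>X\<^sub>i\<close>.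
\<close>

definition total_influence :: "nat \<Rightarrow> ((nat \<Rightarrow> bool) \<Rightarrow> bool) \<Rightarrow> real \<Rightarrow> real" where
  "total_influence n f p =
     (\<Sum>i\<in>{1..n}. measure_pmf.prob (pair_pmf (mu n p) (bernoulli_pmf p))
                    {(x, b). f x \<noteq> f (x(i := b))})"

text \<open>
  \<open>cond_pmf\<close> is meaningful only for an event of positive probability; for \<open>0 < p \<le> 1\<close> the
  point \<open>(1,\<dots>,1)\<close> has positive mass, so this holds for every \<open>S\<close> below.
\<close>

definition boosting_set ::
    "nat \<Rightarrow> ((nat \<Rightarrow> bool) \<Rightarrow> bool) \<Rightarrow> real \<Rightarrow> real \<Rightarrow> nat set \<Rightarrow> bool" where
  "boosting_set n f p \<delta> S \<longleftrightarrow> S \<subseteq> {1..n} \<and>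
     measure_pmf.expectation (cond_pmf (mu n p) {x. \<forall>i\<in>S. x i}) (\<lambda>x. of_bool (f x)) \<ge> 1 - \<delta>"

text \<open>The cardinality bound \<open>k\<close> is a real number.\<close>

definition boosting_event ::
    "nat \<Rightarrow> ((nat \<Rightarrow> bool) \<Rightarrow> bool) \<Rightarrow> real \<Rightarrow> real \<Rightarrow> real \<Rightarrow> (nat \<Rightarrow> bool) set" where
  "boosting_event n f p \<delta> k =
     {x \<in> cube n. \<exists>S \<subseteq> {i \<in> {1..n}. x i}. boosting_set n f p \<delta> S \<and> real (card S) \<le> k}"

end

theory Submission
  imports Defs
begin

text \<open>
  Write \<open>c S\<close> for the \<open>p\<close>-biased Fourier coefficients of \<open>f\<close>. Small total influence confines
  \<open>f\<close> to degree at most \<open>d\<close>, where \<open>d\<close> is of order \<open>\<lceil>I\<rceil> / (\<delta> \<epsilon>)\<close>. Sample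
  \<open>x\<close> as a uniform subset of a \<open>2p\<close>-random set \<open>Z\<close>: on subsets of \<open>Z\<close> the Bonami inequality
  bounds the low-degree weight at coordinates of small influence, and since \<open>c S\<close> is the mean, given
  \<open>S \<subseteq> Z\<close>, of the coefficient of \<open>f\<close> restricted to \<open>Z\<close>, the low-degree coefficients with
  \<open>\<bar>c S\<bar> < \<theta>\<close> have small total mass for some \<open>\<theta> = exp (- O(d\<^sup>2))\<close>. By Parseval, the
  expected number of the remaining sets \<open>S\<close> contained in \<open>x\<close> is bounded. Enlarge the family of
  these by all sets that have many expected extensions in it, and let \<open>J\<close> be the union of the
  members contained in \<open>x\<close>. Then \<open>J\<close> is small on average, and \<open>f\<close> is \<open>L\<^sup>2\<close>-close to a function
  of \<open>J\<close>. By the Harris inequality, conditioning on the value of \<open>J\<close> makes \<open>f = 1\<close> no likelier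
  than conditioning on \<open>J \<subseteq> x\<close>, so where \<open>f = 1\<close> the set \<open>J\<close> is almost always boosting.
\<close>

subsection \<open>Biased Fourier expansion\<close>

text \<open>The mean of \<open>\<phi>\<close> over a \<open>p\<close>-random subset of
  \<open>A\<close>. Points of the cube become sets, so that the ground set can vary under
  restriction and conditioning; the weights are polynomials in \<open>p\<close>.\<close>

definition expect :: "real \<Rightarrow> 'a set \<Rightarrow> ('a set \<Rightarrow> real) \<Rightarrow> real" where
  "expect p A \<phi> = (\<Sum>X\<in>Pow A. p ^ card X * (1 - p) ^ card (A - X) * \<phi> X)"

lemma expect_empty [simp]: "expect p {} \<phi> = \<phi> {}"
  by (simp add: expect_def)

text \<open>Conditioning on whether \<open>i\<close> belongs to the random set; inductions on the
  ground set run on this recursion.\<close>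

lemma expect_insert:
  assumes "finite A" "i \<notin> A"
  shows "expect p (insert i A) \<phi> = p * expect p A (\<lambda>X. \<phi> (insert i X)) + (1 - p) * expect p A \<phi>"
proof -
  have 1: "(\<Sum>X\<in>insert i ` Pow A. p ^ card X * (1 - p) ^ card (insert i A - X) * \<phi> X)
      = p * expect p A (\<lambda>X. \<phi> (insert i X))"
    unfolding expect_def sum_distrib_left
  proof (subst sum.reindex)
    show "inj_on (insert i) (Pow A)"
      using assms(2) by (auto simp: inj_on_def)
    show "sum ((\<lambda>X. p ^ card X * (1 - p) ^ card (insert i A - X) * \<phi> X) \<circ> insert i) (Pow A)
        = (\<Sum>X\<in>Pow A. p * (p ^ card X * (1 - p) ^ card (A - X) * \<phi> (insert i X)))"
    proof (intro sum.cong refl)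
      fix X assume X: "X \<in> Pow A"
      have "insert i A - insert i X = A - X" "i \<notin> X" "finite X"
        using assms X finite_subset[of X A] by auto
      then show "((\<lambda>X. p ^ card X * (1 - p) ^ card (insert i A - X) * \<phi> X) \<circ> insert i) X
        = p * (p ^ card X * (1 - p) ^ card (A - X) * \<phi> (insert i X))" by simp
    qed
  qed
  have 2: "(\<Sum>X\<in>Pow A. p ^ card X * (1 - p) ^ card (insert i A - X) * \<phi> X) = (1 - p) * expect p A \<phi>"
    unfolding expect_def sum_distrib_left
  proof (intro sum.cong refl)
    fix X assume X: "X \<in> Pow A"
    have "insert i A - X = insert i (A - X)" "i \<notin> A - X" "finite (A - X)"
      using assms X by auto
    then show "p ^ card X * (1 - p) ^ card (insert i A - X) * \<phi> X
        = (1 - p) * (p ^ card X * (1 - p) ^ card (A - X) * \<phi> X)" by simp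
  qed
  have "expect p (insert i A) \<phi> = (\<Sum>X\<in>Pow A. p ^ card X * (1 - p) ^ card (insert i A - X) * \<phi> X)
     + (\<Sum>X\<in>insert i ` Pow A. p ^ card X * (1 - p) ^ card (insert i A - X) * \<phi> X)"
    unfolding expect_def Pow_insert
    by (rule sum.union_disjoint) (use assms in auto)
  with 1 2 show ?thesis by simp
qed

lemma expect_remove:
  assumes "finite A" "i \<in> A"
  shows "expect p A \<phi> = p * expect p (A - {i}) (\<lambda>X. \<phi> (insert i X)) + (1 - p) * expect p (A - {i}) \<phi>"
  using expect_insert[of "A - {i}" i p \<phi>] assms by (simp add: insert_absorb)

lemma expect_cong:
  assumes "\<And>X. X \<subseteq> A \<Longrightarrow> \<phi> X = \<psi> X"
  shows "expect p A \<phi> = expect p A \<psi>"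
  unfolding expect_def by (intro sum.cong) (use assms in auto)

lemma expect_add: "expect p A (\<lambda>X. \<phi> X + \<psi> X) = expect p A \<phi> + expect p A \<psi>"
  by (simp add: expect_def algebra_simps sum.distrib)

lemma expect_diff: "expect p A (\<lambda>X. \<phi> X - \<psi> X) = expect p A \<phi> - expect p A \<psi>"
  by (simp add: expect_def algebra_simps sum_subtractf)

lemma expect_cmult: "expect p A (\<lambda>X. c * \<phi> X) = c * expect p A \<phi>"
  by (simp add: expect_def sum_distrib_left mult_ac)

lemma expect_multc: "expect p A (\<lambda>X. \<phi> X * c) = expect p A \<phi> * c"
  using expect_cmult[of p A c \<phi>] by (simp add: mult.commute)

lemma expect_sum: "expect p A (\<lambda>X. \<Sum>s\<in>B. \<phi> s X) = (\<Sum>s\<in>B. expect p A (\<phi> s))"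
  unfolding expect_def sum_distrib_left by (rule sum.swap)

lemma expect_const:
  assumes "finite A"
  shows "expect p A (\<lambda>_. c) = c"
  using assms by (induction A) (simp_all add: expect_insert algebra_simps)

lemma expect_mono:
  assumes "0 \<le> p" "p \<le> 1" "\<And>X. X \<subseteq> A \<Longrightarrow> \<phi> X \<le> \<psi> X"
  shows "expect p A \<phi> \<le> expect p A \<psi>"
  unfolding expect_def by (intro sum_mono mult_left_mono) (use assms in auto)

lemma expect_nonneg:
  assumes "0 \<le> p" "p \<le> 1" "\<And>X. X \<subseteq> A \<Longrightarrow> 0 \<le> \<phi> X"
  shows "0 \<le> expect p A \<phi>"
  unfolding expect_def by (intro sum_nonneg mult_nonneg_nonneg) (use assms in auto)

lemma expect_Cauchy_Schwarz:
  assumes "0 \<le> p" "p \<le> 1"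
  shows "(expect p A (\<lambda>X. \<phi> X * \<psi> X))\<^sup>2 \<le> expect p A (\<lambda>X. (\<phi> X)\<^sup>2) * expect p A (\<lambda>X. (\<psi> X)\<^sup>2)"
proof -
  define w where "w = (\<lambda>X. sqrt (p ^ card X * (1 - p) ^ card (A - X)))"
  have w: "p ^ card X * (1 - p) ^ card (A - X) = (w X)\<^sup>2" for X
    using assms by (simp add: w_def)
  have "(\<Sum>X\<in>Pow A. (w X * \<phi> X) * (w X * \<psi> X))\<^sup>2
      \<le> (\<Sum>X\<in>Pow A. (w X * \<phi> X)\<^sup>2) * (\<Sum>X\<in>Pow A. (w X * \<psi> X)\<^sup>2)"
    by (rule Cauchy_Schwarz_ineq_sum)
  then show ?thesis
    unfolding expect_def w by (simp add: power_mult_distrib power2_eq_square mult_ac)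
qed

text \<open>Independence of the coordinates: each factor sees only whether its own \<open>i\<close>
  belongs to \<open>X\<close>.\<close>

lemma expect_prod:
  assumes "finite A"
  shows "expect p A (\<lambda>X. \<Prod>i\<in>A. h i (i \<in> X)) = (\<Prod>i\<in>A. p * h i True + (1 - p) * h i False)"
  using assms
proof (induction A)
  case (insert j A)
  have "expect p A (\<lambda>X. \<Prod>i\<in>insert j A. h i (i \<in> insert j X)) = expect p A (\<lambda>X. h j True * (\<Prod>i\<in>A. h i (i \<in> X)))"
  proof (intro expect_cong)
    fix X assume "X \<subseteq> A"
    have "(\<Prod>i\<in>A. h i (i \<in> insert j X)) = (\<Prod>i\<in>A. h i (i \<in> X))"
      by (intro prod.cong refl arg_cong[of _ _ "h _"]) (use insert.hyps in auto)
    then show "(\<Prod>i\<in>insert j A. h i (i \<in> insert j X)) = h j True * (\<Prod>i\<in>A. h i (i \<in> X))"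
      using insert.hyps by simp
  qed
  moreover have "expect p A (\<lambda>X. \<Prod>i\<in>insert j A. h i (i \<in> X)) = expect p A (\<lambda>X. h j False * (\<Prod>i\<in>A. h i (i \<in> X)))"
  proof (intro expect_cong)
    fix X assume "X \<subseteq> A"
    then have "j \<notin> X" using insert.hyps by auto
    then show "(\<Prod>i\<in>insert j A. h i (i \<in> X)) = h j False * (\<Prod>i\<in>A. h i (i \<in> X))"
      using insert.hyps by simp
  qed
  ultimately show ?case
    using insert by (simp add: expect_insert expect_cmult algebra_simps)
qed simp

section \<open>Characters for the biased measure: orthogonality and inversion\<close>

definition psi :: "real \<Rightarrow> 'a set \<Rightarrow> 'a set \<Rightarrow> real" where
  "psi p S X = (\<Prod>i\<in>S. of_bool (i \<in> X) - p)"

text \<open>The mean factors over the coordinates. A coordinate in exactly one of \<open>S\<close>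
  and \<open>T\<close> leaves a centred factor of mean 0; one in both leaves the variance
  \<open>p * (1 - p)\<close>.\<close>

lemma psi_orthogonal:
  assumes "finite A" "S \<subseteq> A" "T \<subseteq> A"
  shows "expect p A (\<lambda>X. psi p S X * psi p T X) = (if S = T then (p * (1 - p)) ^ card S else 0)"
proof -
  let ?h = "\<lambda>i b. (if i \<in> S then of_bool b - p else 1) * (if i \<in> T then of_bool b - p else 1)"
  have *: "psi p U X = (\<Prod>i\<in>A. if i \<in> U then of_bool (i \<in> X) - p else 1)" if "U \<subseteq> A" for U X
    using that assms(1) by (simp add: psi_def prod.If_cases Int_absorb1 Int_commute)
  have "expect p A (\<lambda>X. psi p S X * psi p T X) = expect p A (\<lambda>X. \<Prod>i\<in>A. ?h i (i \<in> X))"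
    by (simp add: *[OF assms(2)] *[OF assms(3)] prod.distrib)
  also have "\<dots> = (\<Prod>i\<in>A. p * ?h i True + (1 - p) * ?h i False)"
    by (rule expect_prod[OF assms(1)])
  also have "\<dots> = (if S = T then (p * (1 - p)) ^ card S else 0)"
  proof (cases "S = T")
    case True
    have "(\<Prod>i\<in>A. p * ?h i True + (1 - p) * ?h i False) = (\<Prod>i\<in>A. if i \<in> S then p * (1 - p) else 1)"
      using True by (intro prod.cong) (auto simp: algebra_simps)
    then show ?thesis
      using True assms by (simp add: prod.If_cases Int_absorb1 Int_commute)
  next
    case False
    then obtain i where "i \<in> A" "(i \<in> S) \<noteq> (i \<in> T)" using assms by blast
    then have "p * ?h i True + (1 - p) * ?h i False = 0" by (auto simp: algebra_simps)
    then show ?thesis using False assms(1) \<open>i \<in> A\<close> by (simp only: if_False prod_zero_iff) blast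
  qed
  finally show ?thesis .
qed

lemma expect_psi_inner:
  assumes "finite A"
  shows "expect p A (\<lambda>X. (\<Sum>S\<in>Pow A. a S * psi p S X) * (\<Sum>S\<in>Pow A. b S * psi p S X))
    = (\<Sum>S\<in>Pow A. a S * b S * (p * (1 - p)) ^ card S)"
proof -
  have "expect p A (\<lambda>X. (\<Sum>S\<in>Pow A. a S * psi p S X) * (\<Sum>S\<in>Pow A. b S * psi p S X))
    = expect p A (\<lambda>X. \<Sum>S\<in>Pow A. \<Sum>T\<in>Pow A. (a S * b T) * (psi p S X * psi p T X))"
    by (simp add: sum_product mult_ac)
  also have "\<dots> = (\<Sum>S\<in>Pow A. \<Sum>T\<in>Pow A. (a S * b T) * expect p A (\<lambda>X. psi p S X * psi p T X))"
    by (simp only: expect_sum expect_cmult)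
  also have "\<dots> = (\<Sum>S\<in>Pow A. \<Sum>T\<in>Pow A. if S = T then a S * b T * (p * (1 - p)) ^ card S else 0)"
    by (intro sum.cong refl) (simp add: psi_orthogonal[OF assms])
  also have "\<dots> = (\<Sum>S\<in>Pow A. a S * b S * (p * (1 - p)) ^ card S)"
    using assms by simp
  finally show ?thesis .
qed

lemma expect_psi_square:
  assumes "finite A"
  shows "expect p A (\<lambda>X. (\<Sum>S\<in>Pow A. a S * psi p S X)\<^sup>2) = (\<Sum>S\<in>Pow A. (a S)\<^sup>2 * (p * (1 - p)) ^ card S)"
  using expect_psi_inner[OF assms, of p a a] by (simp add: power2_eq_square)

text \<open>Dividing by the squared norm of the unnormalised character makes this the mean of the
  iterated discrete derivative of \<open>f\<close> in the directions of \<open>S\<close>. In this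
  scaling the coefficients have a bound free of \<open>p\<close> and are compatible with random
  restriction.\<close>

definition coef :: "real \<Rightarrow> 'a set \<Rightarrow> ('a set \<Rightarrow> real) \<Rightarrow> 'a set \<Rightarrow> real" where
  "coef p A f S = expect p A (\<lambda>X. f X * psi p S X) / (p * (1 - p)) ^ card S"

text \<open>Inversion by the reproducing kernel in \<open>ker\<close>: its sum over \<open>S\<close>
  factors over the coordinates, vanishes for \<open>Y \<noteq> X\<close>, and at
  \<open>Y = X\<close> is the reciprocal of the weight of \<open>X\<close>.\<close>

lemma psi_expansion:
  assumes "finite A" "0 < p" "p < 1" "X \<subseteq> A"
  shows "f X = (\<Sum>S\<in>Pow A. coef p A f S * psi p S X)"
proof -
  have ker: "(\<Sum>S\<in>Pow A. psi p S Y * psi p S X / (p * (1 - p)) ^ card S)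
      = (if Y = X then 1 / (p ^ card X * (1 - p) ^ card (A - X)) else 0)" if "Y \<subseteq> A" for Y
  proof -
    let ?g = "\<lambda>i. (of_bool (i \<in> Y) - p) * (of_bool (i \<in> X) - p) / (p * (1 - p))"
    have "(\<Sum>S\<in>Pow A. psi p S Y * psi p S X / (p * (1 - p)) ^ card S) = (\<Sum>S\<in>Pow A. prod ?g S)"
      by (intro sum.cong refl) (simp add: psi_def prod.distrib prod_dividef)
    also have "\<dots> = (\<Prod>i\<in>A. ?g i + 1)"
      using assms(1) by (simp add: prod_add)
    also have "\<dots> = (if Y = X then 1 / (p ^ card X * (1 - p) ^ card (A - X)) else 0)"
    proof (cases "Y = X")
      case True
      have "(\<Prod>i\<in>A. ?g i + 1) = (\<Prod>i\<in>A. if i \<in> X then 1 / p else 1 / (1 - p))"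
        using True assms by (intro prod.cong) (auto simp: field_simps)
      moreover have "A \<inter> - X = A - X" by auto
      ultimately show ?thesis
        using True assms by (simp add: prod.If_cases Int_absorb1 power_one_over)
    next
      case False
      then obtain i where "i \<in> A" "(i \<in> Y) \<noteq> (i \<in> X)" using assms(4) \<open>Y \<subseteq> A\<close> by blast
      then have "?g i + 1 = 0" using assms by (auto simp: field_simps)
      then show ?thesis using False assms(1) \<open>i \<in> A\<close> by (simp only: if_False prod_zero_iff) blast
    qed
    finally show ?thesis .
  qed
  have "(\<Sum>S\<in>Pow A. coef p A f S * psi p S X)
      = (\<Sum>S\<in>Pow A. expect p A (\<lambda>Y. f Y * (psi p S Y * psi p S X / (p * (1 - p)) ^ card S)))"
    unfolding coef_def
  proof (intro sum.cong refl)
    fix S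
    show "expect p A (\<lambda>X. f X * psi p S X) / (p * (1 - p)) ^ card S * psi p S X
      = expect p A (\<lambda>Y. f Y * (psi p S Y * psi p S X / (p * (1 - p)) ^ card S))"
      using expect_multc[of p A "\<lambda>X. f X * psi p S X" "psi p S X / (p * (1 - p)) ^ card S"]
      by (simp add: mult_ac)
  qed
  also have "\<dots> = expect p A (\<lambda>Y. f Y * (\<Sum>S\<in>Pow A. psi p S Y * psi p S X / (p * (1 - p)) ^ card S))"
    by (simp only: sum_distrib_left expect_sum)
  also have "\<dots> = expect p A (\<lambda>Y. f Y * (if Y = X then 1 / (p ^ card X * (1 - p) ^ card (A - X)) else 0))"
    by (intro expect_cong) (simp only: ker)
  also have "\<dots> = (\<Sum>Y\<in>Pow A. if Y = X then f X else 0)"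
    unfolding expect_def by (intro sum.cong refl) (use assms in auto)
  also have "\<dots> = f X" using assms by simp
  finally show ?thesis by simp
qed

lemma Parseval:
  assumes "finite A" "0 < p" "p < 1"
  shows "expect p A (\<lambda>X. (f X)\<^sup>2) = (\<Sum>S\<in>Pow A. (coef p A f S)\<^sup>2 * (p * (1 - p)) ^ card S)"
proof -
  have "expect p A (\<lambda>X. (f X)\<^sup>2) = expect p A (\<lambda>X. (\<Sum>S\<in>Pow A. coef p A f S * psi p S X)\<^sup>2)"
    by (intro expect_cong) (simp only: psi_expansion[OF assms, symmetric])
  then show ?thesis by (simp add: expect_psi_square[OF assms(1)])
qed

lemma psi_insert:
  assumes "finite S" "i \<notin> S"
  shows "psi p (insert i S) X = (of_bool (i \<in> X) - p) * psi p S X"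
  using assms by (simp add: psi_def)

lemma psi_cong:
  assumes "S \<inter> X = S \<inter> Y"
  shows "psi p S X = psi p S Y"
  unfolding psi_def by (intro prod.cong) (use assms in auto)

lemma sum_Pow_remove:
  assumes "finite A" "i \<in> A"
  shows "(\<Sum>S\<in>Pow A. g S) = (\<Sum>S\<in>Pow (A - {i}). g S) + (\<Sum>S\<in>Pow (A - {i}). g (insert i S))"
proof -
  have "Pow A = Pow (A - {i}) \<union> insert i ` Pow (A - {i})"
    using Pow_insert[of i "A - {i}"] assms by (simp add: insert_absorb)
  moreover have "(\<Sum>S\<in>insert i ` Pow (A - {i}). g S) = (\<Sum>S\<in>Pow (A - {i}). g (insert i S))"
    by (subst sum.reindex) (auto simp: inj_on_def)
  moreover have "(\<Sum>S\<in>Pow (A - {i}) \<union> insert i ` Pow (A - {i}). g S)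
    = (\<Sum>S\<in>Pow (A - {i}). g S) + (\<Sum>S\<in>insert i ` Pow (A - {i}). g S)"
    by (rule sum.union_disjoint) (use assms in auto)
  ultimately show ?thesis by simp
qed

text \<open>Characters without \<open>i\<close> cancel. In a character with \<open>i\<close>, the
  factor of \<open>i\<close> jumps from \<open>- p\<close> to \<open>1 - p\<close>, so the
  difference is the character with \<open>i\<close> removed.\<close>

lemma discrete_derivative:
  assumes "finite A" "0 < p" "p < 1" "X \<subseteq> A" "i \<in> A"
  shows "f (insert i X) - f (X - {i}) = (\<Sum>S\<in>Pow A. (if i \<in> S then 0 else coef p A f (insert i S)) * psi p S X)"
proof -
  let ?c = "coef p A f"
  have e: "f Y = (\<Sum>S\<in>Pow (A - {i}). ?c S * psi p S Y) + (\<Sum>S\<in>Pow (A - {i}). ?c (insert i S) * psi p (insert i S) Y)"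
    if "Y \<subseteq> A" for Y
    by (rule trans[OF psi_expansion[OF assms(1-3) that, of f] sum_Pow_remove[OF assms(1,5)]])
  have psi: "psi p S (insert i X) = psi p S X" "psi p S (X - {i}) = psi p S X"
    "psi p (insert i S) (insert i X) = (1 - p) * psi p S X" "psi p (insert i S) (X - {i}) = (- p) * psi p S X"
    if S: "S \<in> Pow (A - {i})" for S
  proof -
    have fin: "finite S" "i \<notin> S" using S assms(1) finite_subset[of S A] by auto
    show 1: "psi p S (insert i X) = psi p S X" by (rule psi_cong) (use fin in auto)
    show 2: "psi p S (X - {i}) = psi p S X" by (rule psi_cong) (use fin in auto)
    show "psi p (insert i S) (insert i X) = (1 - p) * psi p S X" "psi p (insert i S) (X - {i}) = (- p) * psi p S X"
      using psi_insert[OF fin, of p "insert i X"] psi_insert[OF fin, of p "X - {i}"] 1 2 by simp_all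
  qed
  have "insert i X \<subseteq> A" "X - {i} \<subseteq> A" using assms by auto
  then have "f (insert i X) - f (X - {i}) =
     ((\<Sum>S\<in>Pow (A - {i}). ?c S * psi p S X) + (\<Sum>S\<in>Pow (A - {i}). ?c (insert i S) * ((1 - p) * psi p S X)))
   - ((\<Sum>S\<in>Pow (A - {i}). ?c S * psi p S X) + (\<Sum>S\<in>Pow (A - {i}). ?c (insert i S) * ((- p) * psi p S X)))"
    by (simp only: e psi cong: sum.cong)
  then have "f (insert i X) - f (X - {i}) = (\<Sum>S\<in>Pow (A - {i}). ?c (insert i S) * psi p S X)"
    by (simp add: sum_subtractf[symmetric] algebra_simps)
  also have "\<dots> = (\<Sum>S\<in>Pow A. (if i \<in> S then 0 else ?c (insert i S)) * psi p S X)"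
    by (subst sum_Pow_remove[OF assms(1,5)], simp, intro sum.cong) auto
  finally show ?thesis .
qed

subsection \<open>Random restrictions and the Bonami inequality\<close>

lemma coef_insert_notin:
  assumes "finite A" "i \<notin> A" "i \<notin> S"
  shows "coef p (insert i A) f S = p * coef p A (\<lambda>X. f (insert i X)) S + (1 - p) * coef p A f S"
proof -
  have "psi p S (insert i X) = psi p S X" for X by (rule psi_cong) (use assms in auto)
  then show ?thesis
    by (simp add: coef_def expect_insert[OF assms(1,2)] add_divide_distrib)
qed

text \<open>The values \<open>1 - p\<close> and \<open>- p\<close> of the centred indicator, taken
  with probabilities \<open>p\<close> and \<open>1 - p\<close>, give the weights
  \<open>p * (1 - p)\<close> and \<open>- p * (1 - p)\<close>; the denominator cancels them and a
  plain difference remains.\<close>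

lemma coef_insert_in:
  assumes "finite A" "i \<notin> A" "finite S" "i \<notin> S" "0 < p" "p < 1"
  shows "coef p (insert i A) f (insert i S) = coef p A (\<lambda>X. f (insert i X)) S - coef p A f S"
proof -
  have 1: "expect p A (\<lambda>X. f (insert i X) * psi p (insert i S) (insert i X))
      = expect p A (\<lambda>X. (1 - p) * (f (insert i X) * psi p S X))"
  proof (intro expect_cong)
    fix X
    have "psi p S (insert i X) = psi p S X" by (rule psi_cong) (use assms in auto)
    then show "f (insert i X) * psi p (insert i S) (insert i X) = (1 - p) * (f (insert i X) * psi p S X)"
      using assms by (simp add: psi_insert)
  qed
  have 2: "expect p A (\<lambda>X. f X * psi p (insert i S) X) = expect p A (\<lambda>X. (- p) * (f X * psi p S X))"
  proof (intro expect_cong)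
    fix X assume "X \<subseteq> A"
    then have "i \<notin> X" using assms by auto
    then show "f X * psi p (insert i S) X = (- p) * (f X * psi p S X)"
      using assms by (simp add: psi_insert)
  qed
  have "expect p (insert i A) (\<lambda>X. f X * psi p (insert i S) X)
      = p * (1 - p) * (expect p A (\<lambda>X. f (insert i X) * psi p S X) - expect p A (\<lambda>X. f X * psi p S X))"
    unfolding expect_insert[OF assms(1,2)] 1 2 expect_cmult by (simp add: algebra_simps)
  then show ?thesis
    using assms by (simp add: coef_def diff_divide_distrib)
qed

text \<open>An element of \<open>S\<close> produces a difference of two smaller coefficients and at
  most doubles the bound; an element outside \<open>S\<close> only averages.\<close>

lemma abs_coef_le:
  assumes "finite A" "0 < p" "p < 1" "S \<subseteq> A" "\<And>X. \<bar>f X\<bar> \<le> 1"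
  shows "\<bar>coef p A f S\<bar> \<le> 2 ^ card S"
  using assms(1,4,5)
proof (induction A arbitrary: f S)
  case empty
  then show ?case by (simp add: coef_def psi_def)
next
  case (insert i A)
  show ?case
  proof (cases "i \<in> S")
    case False
    then have S: "S \<subseteq> A" using insert.prems by auto
    have "\<bar>coef p A (\<lambda>X. f (insert i X)) S\<bar> \<le> 2 ^ card S" "\<bar>coef p A f S\<bar> \<le> 2 ^ card S"
      using insert.IH[OF S] insert.prems by auto
    then have "\<bar>p * coef p A (\<lambda>X. f (insert i X)) S + (1 - p) * coef p A f S\<bar>
        \<le> p * 2 ^ card S + (1 - p) * 2 ^ card S"
      using assms(2,3) by (intro order.trans[OF abs_triangle_ineq] add_mono) (simp_all add: abs_mult)
    then show ?thesis
      by (simp add: coef_insert_notin insert.hyps False algebra_simps)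
  next
    case True
    define T where "T = S - {i}"
    have T: "S = insert i T" "i \<notin> T" "T \<subseteq> A" "finite T"
      using True insert.prems insert.hyps finite_subset[of T A] by (auto simp: T_def)
    have "\<bar>coef p A (\<lambda>X. f (insert i X)) T\<bar> \<le> 2 ^ card T" "\<bar>coef p A f T\<bar> \<le> 2 ^ card T"
      using insert.IH[OF T(3)] insert.prems by auto
    then show ?thesis
      using T by (simp add: coef_insert_in insert.hyps assms)
  qed
qed

text \<open>
  Read probabilistically, this says that a uniform subset of a \<open>2p\<close>-random set is \<open>p\<close>-random;
  only that reading needs \<open>p \<le> 1/2\<close>.
\<close>

lemma expect_restriction:
  assumes "finite A"
  shows "expect (2 * p) A (\<lambda>Z. expect (1 / 2) Z \<phi>) = expect p A \<phi>"
  using assms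
proof (induction A arbitrary: \<phi>)
  case (insert i A)
  have "expect (2 * p) A (\<lambda>Z. expect (1 / 2) (insert i Z) \<phi>)
      = expect (2 * p) A (\<lambda>Z. 1 / 2 * expect (1 / 2) Z (\<lambda>X. \<phi> (insert i X)) + 1 / 2 * expect (1 / 2) Z \<phi>)"
  proof (intro expect_cong)
    fix Z assume "Z \<subseteq> A"
    then have "finite Z" "i \<notin> Z" using insert.hyps finite_subset by auto
    then show "expect (1 / 2) (insert i Z) \<phi>
        = 1 / 2 * expect (1 / 2) Z (\<lambda>X. \<phi> (insert i X)) + 1 / 2 * expect (1 / 2) Z \<phi>"
      by (simp add: expect_insert)
  qed
  also have "\<dots> = 1 / 2 * expect p A (\<lambda>X. \<phi> (insert i X)) + 1 / 2 * expect p A \<phi>"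
    by (simp only: expect_add expect_cmult insert.IH)
  finally show ?case
    unfolding expect_insert[OF insert.hyps] insert.IH by (simp add: field_simps)
qed simp

text \<open>Means of discrete derivatives can be taken in two stages. An element outside
  \<open>S\<close> is averaged, and the two stages combine to rate \<open>p\<close>. An element of
  \<open>S\<close> must lie in \<open>Z\<close>, which brings a factor \<open>2 * p\<close>, and
  then gives the same difference as in \<open>coef p\<close>.\<close>

lemma expect_restriction_coef:
  assumes "finite A" "S \<subseteq> A" "0 < p" "p < 1"
  shows "expect (2 * p) A (\<lambda>Z. if S \<subseteq> Z then coef (1 / 2) Z f S else 0) = (2 * p) ^ card S * coef p A f S"
  using assms(1,2)
proof (induction A arbitrary: f S)
  case empty
  then show ?case by (simp add: coef_def psi_def)
next
  case (insert i A)
  have Z: "finite Z" "i \<notin> Z" if "Z \<subseteq> A" for Z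
    using that insert.hyps finite_subset by auto
  let ?g = "\<lambda>X. f (insert i X)"
  show ?case
  proof (cases "i \<in> S")
    case False
    then have S: "S \<subseteq> A" using insert.prems by auto
    have "expect (2 * p) A (\<lambda>Z. if S \<subseteq> insert i Z then coef (1 / 2) (insert i Z) f S else 0)
      = expect (2 * p) A (\<lambda>Z. 1 / 2 * (if S \<subseteq> Z then coef (1 / 2) Z ?g S else 0) +
          1 / 2 * (if S \<subseteq> Z then coef (1 / 2) Z f S else 0))"
      by (intro expect_cong) (use False in \<open>auto simp: coef_insert_notin Z subset_insert\<close>)
    also have "\<dots> = 1 / 2 * ((2 * p) ^ card S * coef p A ?g S) + 1 / 2 * ((2 * p) ^ card S * coef p A f S)"
      by (simp only: expect_add expect_cmult insert.IH[OF S])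
    finally show ?thesis
      unfolding expect_insert[OF insert.hyps] insert.IH[OF S] coef_insert_notin[OF insert.hyps False]
      by (simp add: algebra_simps)
  next
    case True
    define T where "T = S - {i}"
    have T: "S = insert i T" "i \<notin> T" "T \<subseteq> A" "finite T"
      using True insert.prems insert.hyps finite_subset[of T A] by (auto simp: T_def)
    have "expect (2 * p) A (\<lambda>Z. if S \<subseteq> insert i Z then coef (1 / 2) (insert i Z) f S else 0)
      = expect (2 * p) A (\<lambda>Z. (if T \<subseteq> Z then coef (1 / 2) Z ?g T else 0) -
          (if T \<subseteq> Z then coef (1 / 2) Z f T else 0))"
    proof (intro expect_cong)
      fix Z assume Z': "Z \<subseteq> A"
      have "insert i T \<subseteq> insert i Z \<longleftrightarrow> T \<subseteq> Z" using T by auto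
      then show "(if S \<subseteq> insert i Z then coef (1 / 2) (insert i Z) f S else 0)
         = (if T \<subseteq> Z then coef (1 / 2) Z ?g T else 0) - (if T \<subseteq> Z then coef (1 / 2) Z f T else 0)"
        unfolding T(1) using coef_insert_in[OF Z[OF Z'] T(4,2), of "1/2" f] by simp
    qed
    also have "\<dots> = (2 * p) ^ card T * coef p A ?g T - (2 * p) ^ card T * coef p A f T"
      by (simp only: expect_diff insert.IH[OF T(3)])
    also have "\<dots> = (2 * p) ^ card T * coef p (insert i A) f S"
      unfolding T(1) coef_insert_in[OF insert.hyps T(4,2) assms(3,4)] by (simp add: algebra_simps)
    finally have 1: "expect (2 * p) A (\<lambda>Z. if S \<subseteq> insert i Z then coef (1 / 2) (insert i Z) f S else 0)
      = (2 * p) ^ card T * coef p (insert i A) f S" .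
    have "expect (2 * p) A (\<lambda>Z. if S \<subseteq> Z then coef (1 / 2) Z f S else 0) = expect (2 * p) A (\<lambda>Z. 0)"
      by (intro expect_cong) (use True insert.hyps in auto)
    then show ?thesis
      unfolding expect_insert[OF insert.hyps] 1 using T insert.hyps by (simp add: expect_const)
  qed
qed

text \<open>Given \<open>U \<subseteq> X\<close>, the remainder is a fresh random subset of
  \<open>A - U\<close>. The probability of the condition is kept as a factor, which avoids a
  division.\<close>

lemma expect_superset:
  assumes "finite A" "U \<subseteq> A"
  shows "expect p A (\<lambda>X. of_bool (U \<subseteq> X) * \<phi> X) = p ^ card U * expect p (A - U) (\<lambda>Y. \<phi> (U \<union> Y))"
proof -
  have "finite U" using assms finite_subset by blast
  then show ?thesis using assms
  proof (induction U arbitrary: A \<phi>)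
    case (insert i U)
    have A: "finite (A - {i})" "U \<subseteq> A - {i}" "i \<in> A" using insert by auto
    have "expect p (A - {i}) (\<lambda>X. of_bool (insert i U \<subseteq> insert i X) * \<phi> (insert i X))
      = expect p (A - {i}) (\<lambda>X. of_bool (U \<subseteq> X) * \<phi> (insert i X))"
      by (intro expect_cong) (use insert.hyps in auto)
    also have "\<dots> = p ^ card U * expect p (A - {i} - U) (\<lambda>Y. \<phi> (insert i (U \<union> Y)))"
      by (rule insert.IH[OF A(1,2)])
    also have "A - {i} - U = A - insert i U" by auto
    finally have 1: "expect p (A - {i}) (\<lambda>X. of_bool (insert i U \<subseteq> insert i X) * \<phi> (insert i X))
      = p ^ card U * expect p (A - insert i U) (\<lambda>Y. \<phi> (insert i (U \<union> Y)))" .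
    have "expect p (A - {i}) (\<lambda>X. of_bool (insert i U \<subseteq> X) * \<phi> X) = expect p (A - {i}) (\<lambda>X. 0)"
      by (intro expect_cong) auto
    then show ?case
      unfolding expect_remove[OF insert.prems(1) A(3)] 1 using insert.hyps A by (simp add: expect_const)
  qed simp
qed

lemma expect_contains:
  assumes "finite A" "U \<subseteq> A"
  shows "expect p A (\<lambda>X. of_bool (U \<subseteq> X)) = p ^ card U"
  using expect_superset[OF assms, of p "\<lambda>_. 1"] assms by (simp add: expect_const)

text \<open>The weight is \<open>3/4\<close> rather than \<open>3\<close> because \<open>psi (1/2)\<close> takes the values \<open>\<plusminus>1/2\<close>.\<close>

lemma Bonami:
  assumes "finite A"
  shows "expect (1 / 2) A (\<lambda>X. (\<Sum>S\<in>Pow A. a S * psi (1 / 2) S X) ^ 4) \<le> (\<Sum>S\<in>Pow A. (3 / 4) ^ card S * (a S)\<^sup>2)\<^sup>2"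
  using assms
proof (induction A arbitrary: a)
  case empty
  then show ?case by (simp add: psi_def)
next
  case (insert i A)
  let ?u = "\<lambda>X. \<Sum>S\<in>Pow A. a S * psi (1 / 2) S X"
  let ?v = "\<lambda>X. \<Sum>S\<in>Pow A. a (insert i S) * psi (1 / 2) S X"
  let ?s = "\<lambda>X. \<Sum>S\<in>Pow (insert i A). a S * psi (1 / 2) S X"
  define x where "x = (\<Sum>S\<in>Pow A. (3 / 4) ^ card S * (a S)\<^sup>2)"
  define y where "y = (\<Sum>S\<in>Pow A. (3 / 4) ^ card S * (a (insert i S))\<^sup>2)"
  have fin: "finite S" "i \<notin> S" if "S \<subseteq> A" for S
    using that insert.hyps finite_subset by auto
  have rem: "(\<Sum>S\<in>Pow (insert i A). g S) = (\<Sum>S\<in>Pow A. g S) + (\<Sum>S\<in>Pow A. g (insert i S))" for g :: "'a set \<Rightarrow> real"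
    using sum_Pow_remove[of "insert i A" i g] insert.hyps by simp
  have s1: "?s (insert i X) = ?u X + 1 / 2 * ?v X" for X
  proof -
    have "psi (1 / 2) S (insert i X) = psi (1 / 2) S X" if "S \<subseteq> A" for S
      by (rule psi_cong) (use fin[OF that] in auto)
    then show ?thesis
      by (simp add: rem psi_insert fin sum_distrib_left sum.distrib[symmetric] algebra_simps cong: sum.cong_simp)
  qed
  have s0: "?s X = ?u X - 1 / 2 * ?v X" if "X \<subseteq> A" for X
  proof -
    have "i \<notin> X" using that insert.hyps by auto
    then show ?thesis
      by (simp add: rem psi_insert fin sum_distrib_left sum_negf algebra_simps cong: sum.cong_simp)
  qed
  have xy: "0 \<le> x" "0 \<le> y" unfolding x_def y_def by (auto intro!: sum_nonneg)
  have u4: "expect (1 / 2) A (\<lambda>X. ?u X ^ 4) \<le> x\<^sup>2" unfolding x_def by (rule insert.IH)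
  have v4: "expect (1 / 2) A (\<lambda>X. ?v X ^ 4) \<le> y\<^sup>2" unfolding y_def by (rule insert.IH)
  \<comment> \<open>The mixed moment is controlled by the two fourth moments.\<close>
  have "(expect (1 / 2) A (\<lambda>X. (?u X)\<^sup>2 * (?v X)\<^sup>2))\<^sup>2
      \<le> expect (1 / 2) A (\<lambda>X. ((?u X)\<^sup>2)\<^sup>2) * expect (1 / 2) A (\<lambda>X. ((?v X)\<^sup>2)\<^sup>2)"
    by (rule expect_Cauchy_Schwarz) auto
  also have "\<dots> = expect (1 / 2) A (\<lambda>X. ?u X ^ 4) * expect (1 / 2) A (\<lambda>X. ?v X ^ 4)" by simp
  also have "\<dots> \<le> x\<^sup>2 * y\<^sup>2" by (intro mult_mono u4 v4 expect_nonneg) auto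
  finally have "(expect (1 / 2) A (\<lambda>X. (?u X)\<^sup>2 * (?v X)\<^sup>2))\<^sup>2 \<le> (x * y)\<^sup>2" by (simp add: power_mult_distrib)
  then have uv: "expect (1 / 2) A (\<lambda>X. (?u X)\<^sup>2 * (?v X)\<^sup>2) \<le> x * y"
    by (rule power2_le_imp_le) (use xy in simp)
  have "expect (1 / 2) (insert i A) (\<lambda>X. ?s X ^ 4)
      = expect (1 / 2) A (\<lambda>X. 1 / 2 * (?u X + 1 / 2 * ?v X) ^ 4 + 1 / 2 * (?u X - 1 / 2 * ?v X) ^ 4)"
    unfolding expect_insert[OF insert.hyps] s1 expect_add expect_cmult
    by (simp add: s0 cong: expect_cong)
  \<comment> \<open>The odd powers of \<open>?v X\<close> cancel between the two equally likely
    values of the coordinate \<open>i\<close>.\<close>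
  also have "\<dots> = expect (1 / 2) A (\<lambda>X. ?u X ^ 4 + 3 / 2 * ((?u X)\<^sup>2 * (?v X)\<^sup>2) + 1 / 16 * ?v X ^ 4)"
    by (intro expect_cong) (simp add: power4_eq_xxxx power2_eq_square field_simps)
  also have "\<dots> \<le> x\<^sup>2 + 3 / 2 * (x * y) + 1 / 16 * y\<^sup>2"
    unfolding expect_add expect_cmult using u4 v4 uv by linarith
  \<comment> \<open>The weight \<open>3 / 4\<close> matches the mixed term
    \<open>3 / 2 * (x * y)\<close>; the last term has room to spare, \<open>1 / 16\<close> against
    \<open>9 / 16\<close>.\<close>
  also have "\<dots> \<le> (x + 3 / 4 * y)\<^sup>2"
    by (simp add: power2_eq_square algebra_simps)
  also have "x + 3 / 4 * y = (\<Sum>S\<in>Pow (insert i A). (3 / 4) ^ card S * (a S)\<^sup>2)"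
    by (simp add: rem x_def y_def fin sum_distrib_left mult_ac cong: sum.cong_simp)
  finally show ?case .
qed

text \<open>The probability that \<open>i\<close> is pivotal. The influence by resampling is
  \<open>2 * p * (1 - p)\<close> times this quantity, see \<open>total_influence_eq\<close>.\<close>

definition influence :: "real \<Rightarrow> 'a set \<Rightarrow> ('a set \<Rightarrow> bool) \<Rightarrow> 'a \<Rightarrow> real" where
  "influence p A F i = expect p A (\<lambda>X. of_bool (F (insert i X) \<noteq> F (X - {i})))"

text \<open>A level inequality. The truncated derivative \<open>?u\<close> has inner product
  \<open>w\<close> with the derivative \<open>?D\<close>, which lives on the pivotal event of
  probability \<open>m\<close>. Two applications of Cauchy-Schwarz bound \<open>w ^ 4\<close> by
  \<open>m ^ 3\<close> times the fourth moment of \<open>?u\<close>, and the Bonami inequality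
  bounds that moment by \<open>9 ^ d * w\<^sup>2\<close>.\<close>

lemma low_degree_weight:
  fixes F :: "'a set \<Rightarrow> bool" and d :: nat
  assumes "finite A" "i \<in> A"
  defines "v \<equiv> \<Sum>S | S \<subseteq> A \<and> i \<in> S \<and> card S \<le> d. (coef (1 / 2) A (\<lambda>X. of_bool (F X)) S)\<^sup>2 / 4 ^ card S"
  shows "v\<^sup>2 \<le> 9 ^ d * influence (1 / 2) A F i ^ 3"
proof -
  let ?c = "coef (1 / 2) A (\<lambda>X. of_bool (F X))"
  \<comment> \<open>Coefficients of the derivative in direction \<open>i\<close>, cut at
    \<open>card T < d\<close> because \<open>insert i T\<close> has one more element.\<close>
  define b where "b T = (if i \<in> T \<or> d \<le> card T then 0 else ?c (insert i T))" for T
  define m where "m = influence (1 / 2) A F i"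
  define w where "w = (\<Sum>T\<in>Pow A. (b T)\<^sup>2 * (1 / 4) ^ card T)"
  let ?D = "\<lambda>X. of_bool (F (insert i X)) - of_bool (F (X - {i})) :: real"
  let ?P = "\<lambda>X. of_bool (F (insert i X) \<noteq> F (X - {i})) :: real"
  let ?u = "\<lambda>X. \<Sum>T\<in>Pow A. b T * psi (1 / 2) T X"
  have fin: "finite T" "i \<notin> T" if "T \<subseteq> A - {i}" for T
    using that assms(1) finite_subset by auto
  have "v = (\<Sum>S\<in>Pow A. if i \<in> S \<and> card S \<le> d then (?c S)\<^sup>2 / 4 ^ card S else 0)"
    unfolding v_def using assms(1) by (simp add: sum.inter_filter[symmetric])
  also have "\<dots> = (\<Sum>T\<in>Pow (A - {i}). if card T < d then (?c (insert i T))\<^sup>2 / (4 * 4 ^ card T) else 0)"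
  proof -
    have "(\<Sum>T\<in>Pow (A - {i}). if i \<in> T \<and> card T \<le> d then (?c T)\<^sup>2 / 4 ^ card T else 0) = 0"
      by (intro sum.neutral) auto
    then show ?thesis
      unfolding sum_Pow_remove[OF assms(1,2)]
      by (simp add: fin Suc_le_eq cong: sum.cong_simp) (intro sum.cong refl, use fin in auto)
  qed
  finally have v: "v = (\<Sum>T\<in>Pow (A - {i}). if card T < d then (?c (insert i T))\<^sup>2 / (4 * 4 ^ card T) else 0)" .
  have "w = (\<Sum>T\<in>Pow (A - {i}). (b T)\<^sup>2 * (1 / 4) ^ card T)"
    unfolding w_def sum_Pow_remove[OF assms(1,2)] by (simp add: b_def)
  also have "\<dots> = (\<Sum>T\<in>Pow (A - {i}). 4 * (if card T < d then (?c (insert i T))\<^sup>2 / (4 * 4 ^ card T) else 0))"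
    by (intro sum.cong refl) (auto simp: b_def power_one_over divide_simps)
  \<comment> \<open>The 4 appears because removing \<open>i\<close> from a set removes one factor
    \<open>1 / 4\<close> from its weight.\<close>
  finally have w: "w = 4 * v" unfolding v sum_distrib_left .
  have "expect (1 / 2) A (\<lambda>X. ?D X * ?u X)
      = expect (1 / 2) A (\<lambda>X. (\<Sum>T\<in>Pow A. (if i \<in> T then 0 else ?c (insert i T)) * psi (1 / 2) T X) * ?u X)"
    by (intro expect_cong) (subst discrete_derivative[where p = "1 / 2", OF assms(1) _ _ _ assms(2)], auto)
  also have "\<dots> = w"
    unfolding expect_psi_inner[OF assms(1)] w_def
    by (intro sum.cong refl) (auto simp: b_def power2_eq_square)
  finally have "w = expect (1 / 2) A (\<lambda>X. ?D X * ?u X)" by simp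
  \<comment> \<open>\<open>?D\<close> takes the values -1, 0, 1 and is nonzero exactly where
    \<open>?P\<close> is 1. The indicator is doubled so that Cauchy-Schwarz can extract one
    copy.\<close>
  also have "\<dots> \<le> expect (1 / 2) A (\<lambda>X. ?P X * (?P X * \<bar>?u X\<bar>))"
    by (intro expect_mono) auto
  finally have 1: "w \<le> expect (1 / 2) A (\<lambda>X. ?P X * (?P X * \<bar>?u X\<bar>))" .
  have w0: "0 \<le> w" unfolding w_def by (intro sum_nonneg) auto
  have m0: "0 \<le> m" unfolding m_def influence_def by (intro expect_nonneg) auto
  have "w\<^sup>2 \<le> (expect (1 / 2) A (\<lambda>X. ?P X * (?P X * \<bar>?u X\<bar>)))\<^sup>2"
    using 1 w0 by (rule power_mono)
  also have "\<dots> \<le> expect (1 / 2) A (\<lambda>X. (?P X)\<^sup>2) * expect (1 / 2) A (\<lambda>X. (?P X * \<bar>?u X\<bar>)\<^sup>2)"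
    by (rule expect_Cauchy_Schwarz) auto
  also have "\<dots> = m * expect (1 / 2) A (\<lambda>X. ?P X * (?u X)\<^sup>2)"
    unfolding m_def influence_def
    by (intro arg_cong2[of _ _ _ _ "(*)"] expect_cong) (auto simp: power_mult_distrib)
  finally have 2: "w\<^sup>2 \<le> m * expect (1 / 2) A (\<lambda>X. ?P X * (?u X)\<^sup>2)" .
  have "(expect (1 / 2) A (\<lambda>X. ?P X * (?u X)\<^sup>2))\<^sup>2 \<le> expect (1 / 2) A (\<lambda>X. (?P X)\<^sup>2) * expect (1 / 2) A (\<lambda>X. ((?u X)\<^sup>2)\<^sup>2)"
    by (rule expect_Cauchy_Schwarz) auto
  also have "\<dots> = m * expect (1 / 2) A (\<lambda>X. ?u X ^ 4)"
    unfolding m_def influence_def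
    by (intro arg_cong2[of _ _ _ _ "(*)"] expect_cong) auto
  also have "\<dots> \<le> m * (\<Sum>T\<in>Pow A. (3 / 4) ^ card T * (b T)\<^sup>2)\<^sup>2"
    by (intro mult_left_mono Bonami assms m0)
  also have "\<dots> \<le> m * (3 ^ d * w)\<^sup>2"
  proof (intro mult_left_mono power_mono m0)
    show "(\<Sum>T\<in>Pow A. (3 / 4) ^ card T * (b T)\<^sup>2) \<le> 3 ^ d * w"
      unfolding w_def sum_distrib_left
    proof (intro sum_mono)
      fix T :: "'a set"
      have "(3::real) ^ card T \<le> 3 ^ d" if "card T < d" using that by (intro power_increasing) auto
      then show "(3 / 4) ^ card T * (b T)\<^sup>2 \<le> 3 ^ d * ((b T)\<^sup>2 * (1 / 4) ^ card T)"
        by (auto simp: b_def power_divide divide_simps intro!: mult_right_mono)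
    qed
  qed (auto intro!: sum_nonneg)
  finally have 3: "(expect (1 / 2) A (\<lambda>X. ?P X * (?u X)\<^sup>2))\<^sup>2 \<le> m * (3 ^ d * w)\<^sup>2" .
  have "(w\<^sup>2)\<^sup>2 \<le> (m * expect (1 / 2) A (\<lambda>X. ?P X * (?u X)\<^sup>2))\<^sup>2"
    using 2 by (rule power_mono) simp
  also have "\<dots> \<le> m\<^sup>2 * (m * (3 ^ d * w)\<^sup>2)"
    unfolding power_mult_distrib using 3 by (intro mult_left_mono) (auto simp: power_mult_distrib)
  also have "\<dots> = (9 ^ d * m ^ 3) * w\<^sup>2"
  proof -
    have "(3 ^ d)\<^sup>2 = (9::real) ^ d" by (simp add: power_mult[symmetric] mult.commute[of d] power_mult)
    then show ?thesis by (simp add: power_mult_distrib power2_eq_square power3_eq_cube)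
  qed
  finally have 4: "w\<^sup>2 * w\<^sup>2 \<le> (9 ^ d * m ^ 3) * w\<^sup>2" by (simp add: power2_eq_square mult_ac)
  have "w\<^sup>2 \<le> 9 ^ d * m ^ 3"
  proof (cases "w = 0")
    case True
    then show ?thesis using m0 by simp
  next
    case False
    then show ?thesis using mult_right_le_imp_le[OF 4] by simp
  qed
  moreover have "v\<^sup>2 \<le> w\<^sup>2" unfolding w by (simp add: power_mult_distrib)
  ultimately show ?thesis unfolding m_def by linarith
qed

subsection \<open>Low-degree coefficients below a threshold\<close>

lemma card_small_subsets_le:
  assumes "finite J"
  shows "card {S. S \<subseteq> J \<and> card S \<le> d} \<le> (card J + 1) ^ d"
proof -
  have "{S. S \<subseteq> J \<and> card S \<le> d} = (\<Union>j\<le>d. {S. S \<subseteq> J \<and> card S = j})" by auto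
  then have "card {S. S \<subseteq> J \<and> card S \<le> d} \<le> (\<Sum>j\<le>d. card {S. S \<subseteq> J \<and> card S = j})"
    using card_UN_le[of "{..d}" "\<lambda>j. {S. S \<subseteq> J \<and> card S = j}"] by simp
  \<comment> \<open>The inserted factor \<open>d choose j\<close> is at least 1 and turns the sum
    into a binomial expansion.\<close>
  also have "\<dots> \<le> (\<Sum>j\<le>d. (d choose j) * card J ^ j)"
  proof (intro sum_mono)
    fix j assume j: "j \<in> {..d}"
    have "card J choose j \<le> card J ^ j"
      by (cases "j \<le> card J") (auto simp: binomial_le_pow binomial_eq_0)
    also have "\<dots> \<le> (d choose j) * card J ^ j"
      using j zero_less_binomial[of j d] by (simp add: Suc_le_eq)
    finally show "card {S. S \<subseteq> J \<and> card S = j} \<le> (d choose j) * card J ^ j"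
      using n_subsets[OF assms] by simp
  qed
  also have "\<dots> = (card J + 1) ^ d" using binomial[of "card J" 1 d] by simp
  finally show ?thesis .
qed

text \<open>Whether \<open>i\<close> is pivotal depends only on \<open>X - {i}\<close>. The event
  \<open>i \<in> Z\<close> contributes \<open>2 * p\<close>, and a uniform subset of the rest of
  \<open>Z\<close> is \<open>p\<close>-random.\<close>

lemma influence_restriction:
  assumes "finite A" "i \<in> A"
  shows "expect (2 * p) A (\<lambda>Z. if i \<in> Z then influence (1 / 2) Z F i else 0) = 2 * p * influence p A F i"
proof -
  let ?h = "\<lambda>X. of_bool (F (insert i X) \<noteq> F X) :: real"
  have inf: "influence q (insert i Z) F i = expect q Z ?h" if "i \<notin> Z" "finite Z" for q Z
  proof -
    have "expect q Z (\<lambda>X. of_bool (F (insert i X) \<noteq> F (X - {i}))) = expect q Z ?h"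
      using that(1) by (intro expect_cong) (auto simp: subset_eq Diff_triv)
    moreover have "expect q Z (\<lambda>X. of_bool (F (insert i X) \<noteq> F (insert i X - {i}))) = expect q Z ?h"
    proof (intro expect_cong)
      fix X assume "X \<subseteq> Z"
      then have "insert i X - {i} = X" using that(1) by auto
      then show "of_bool (F (insert i X) \<noteq> F (insert i X - {i})) = ?h X" by simp
    qed
    ultimately show ?thesis
      unfolding influence_def using that by (simp add: expect_insert algebra_simps)
  qed
  have "expect (2 * p) (A - {i}) (\<lambda>Z. if i \<in> Z then influence (1 / 2) Z F i else 0) = expect (2 * p) (A - {i}) (\<lambda>Z. 0)"
    by (intro expect_cong) auto
  moreover have "expect (2 * p) (A - {i}) (\<lambda>Z. influence (1 / 2) (insert i Z) F i) = expect (2 * p) (A - {i}) (\<lambda>Z. expect (1 / 2) Z ?h)"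
  proof (intro expect_cong)
    fix Z assume "Z \<subseteq> A - {i}"
    then have "i \<notin> Z" "finite Z" using assms(1) finite_subset by auto
    then show "influence (1 / 2) (insert i Z) F i = expect (1 / 2) Z ?h" by (rule inf)
  qed
  moreover have "influence p A F i = expect p (A - {i}) ?h"
    using inf[of "A - {i}" p] assms by (simp add: insert_absorb)
  ultimately show ?thesis
    unfolding expect_remove[OF assms]
    by (simp add: expect_const assms(1) expect_restriction)
qed

text \<open>The level inequality made linear in the influence: multiply it by
  \<open>v \<le> t ^ 3\<close> and take cube roots.\<close>

lemma low_degree_weight_le:
  fixes F :: "'a set \<Rightarrow> bool" and d :: nat
  assumes "finite A" "i \<in> A" "0 \<le> t"
  defines "v \<equiv> \<Sum>S | S \<subseteq> A \<and> i \<in> S \<and> card S \<le> d. (coef (1 / 2) A (\<lambda>X. of_bool (F X)) S)\<^sup>2 / 4 ^ card S"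
  assumes "v \<le> t ^ 3"
  shows "v \<le> 3 ^ d * t * influence (1 / 2) A F i"
proof -
  let ?m = "influence (1 / 2) A F i"
  have v: "v\<^sup>2 \<le> 9 ^ d * ?m ^ 3" unfolding v_def by (rule low_degree_weight[OF assms(1,2)])
  have m: "0 \<le> ?m" unfolding influence_def by (intro expect_nonneg) auto
  have v0: "0 \<le> v" unfolding v_def by (intro sum_nonneg) auto
  have "v ^ 3 = v * v\<^sup>2" by (simp add: power3_eq_cube power2_eq_square)
  also have "\<dots> \<le> t ^ 3 * (27 ^ d * ?m ^ 3)"
  proof (intro mult_mono assms(5))
    \<comment> \<open>Enlarging 9 to 27 makes the right-hand side a cube.\<close>
    have "9 ^ d * ?m ^ 3 \<le> 27 ^ d * ?m ^ 3" using m by (intro mult_right_mono power_mono) auto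
    with v show "v\<^sup>2 \<le> 27 ^ d * ?m ^ 3" by linarith
  qed (use assms(3) in auto)
  also have "\<dots> = (3 ^ d * t * ?m) ^ 3"
  proof -
    have "(27::real) ^ d = (3 ^ d) ^ 3" by (simp add: power_mult[symmetric] mult.commute[of d] power_mult)
    then show ?thesis by (simp add: power_mult_distrib)
  qed
  finally have "v ^ Suc 2 \<le> (3 ^ d * t * ?m) ^ Suc 2" by simp
  then show ?thesis
    by (rule power_le_imp_le_base) (use m assms(3) in simp)
qed

text \<open>Only the few coordinates in \<open>J\<close> carry low-degree weight above
  \<open>t ^ 3\<close>. There are few sets inside \<open>J\<close>, each contributing at most
  \<open>\<theta> * 2 ^ d\<close>. For the other sets
  \<open>2 * a * b \<le> a\<^sup>2 + b\<^sup>2\<close> is used, and the square of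
  \<open>cZ S\<close> is charged to an element of \<open>S\<close> outside \<open>J\<close>, where
  the weight is bounded by the influence.\<close>

lemma small_coef_mass_restricted:
  fixes F :: "'a set \<Rightarrow> bool" and c :: "'a set \<Rightarrow> real"
  assumes "finite Z" "0 \<le> \<theta>" "0 < t" "\<And>S. S \<in> H \<Longrightarrow> S \<subseteq> Z \<and> card S \<le> d \<and> \<bar>c S\<bar> \<le> \<theta>"
  defines "cZ \<equiv> coef (1 / 2) Z (\<lambda>X. of_bool (F X))"
  shows "(\<Sum>S\<in>H. c S * cZ S) \<le> \<theta> * 2 ^ d * (d / t ^ 3 + 1) ^ d
    + 1 / 2 * (\<Sum>S\<in>H. (c S)\<^sup>2) + 1 / 2 * 12 ^ d * t * (\<Sum>i\<in>Z. influence (1 / 2) Z F i)"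
proof -
  define v where "v i = (\<Sum>S | S \<subseteq> Z \<and> i \<in> S \<and> card S \<le> d. (cZ S)\<^sup>2 / 4 ^ card S)" for i
  define J where "J = {i \<in> Z. t ^ 3 < v i}"
  have finH: "finite H" by (rule finite_subset[of _ "Pow Z"]) (use assms in auto)
  have finJ: "finite J" "J \<subseteq> Z" using assms(1) by (auto simp: J_def)
  \<comment> \<open>Double counting: \<open>S\<close> is counted once for each of its elements in
    \<open>B\<close>.\<close>
  have swap: "(\<Sum>i\<in>B. v i) = (\<Sum>S | S \<subseteq> Z \<and> card S \<le> d. card (B \<inter> S) * ((cZ S)\<^sup>2 / 4 ^ card S))"
    if "finite B" for B
  proof -
    have "(\<Sum>i\<in>B. v i) = (\<Sum>i\<in>B. \<Sum>S | S \<subseteq> Z \<and> card S \<le> d. if i \<in> S then (cZ S)\<^sup>2 / 4 ^ card S else 0)"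
    proof (intro sum.cong refl)
      fix i
      have "{S. S \<subseteq> Z \<and> i \<in> S \<and> card S \<le> d} = {S \<in> {S. S \<subseteq> Z \<and> card S \<le> d}. i \<in> S}" by auto
      then show "v i = (\<Sum>S | S \<subseteq> Z \<and> card S \<le> d. if i \<in> S then (cZ S)\<^sup>2 / 4 ^ card S else 0)"
        unfolding v_def using assms(1) by (simp only:) (rule sum.inter_filter, simp)
    qed
    also have "\<dots> = (\<Sum>S | S \<subseteq> Z \<and> card S \<le> d. \<Sum>i\<in>B. if i \<in> S then (cZ S)\<^sup>2 / 4 ^ card S else 0)"
      by (rule sum.swap)
    also have "\<dots> = (\<Sum>S | S \<subseteq> Z \<and> card S \<le> d. card (B \<inter> S) * ((cZ S)\<^sup>2 / 4 ^ card S))"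
      using that by (simp add: sum.If_cases)
    finally show ?thesis .
  qed
  \<comment> \<open>The \<open>v i\<close> sum to at most \<open>d\<close>: each \<open>S\<close> is
    counted at most \<open>d\<close> times, and by Parseval the total weight is at most 1.\<close>
  have "card J * t ^ 3 = (\<Sum>i\<in>J. t ^ 3)" by simp
  also have "\<dots> \<le> (\<Sum>i\<in>J. v i)" by (intro sum_mono) (auto simp: J_def)
  also have "\<dots> \<le> (\<Sum>S | S \<subseteq> Z \<and> card S \<le> d. d * ((cZ S)\<^sup>2 / 4 ^ card S))"
    unfolding swap[OF finJ(1)]
  proof (intro sum_mono mult_right_mono)
    fix S assume "S \<in> {S. S \<subseteq> Z \<and> card S \<le> d}"
    moreover from this have "card (J \<inter> S) \<le> card S"
      using assms(1) finite_subset by (intro card_mono) auto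
    ultimately show "real (card (J \<inter> S)) \<le> real d" by simp
  qed auto
  also have "\<dots> \<le> (\<Sum>S\<in>Pow Z. d * ((cZ S)\<^sup>2 / 4 ^ card S))"
    using assms(1) by (intro sum_mono2) auto
  also have "\<dots> = d * expect (1 / 2) Z (\<lambda>X. (of_bool (F X))\<^sup>2)"
    unfolding Parseval[of Z "1 / 2", simplified, OF assms(1)] cZ_def
    by (simp add: sum_distrib_left power_one_over)
  also have "\<dots> \<le> d * expect (1 / 2) Z (\<lambda>X. 1)"
    by (intro mult_left_mono expect_mono) auto
  finally have cardJ: "card J \<le> d / t ^ 3"
    using assms(1,3) by (simp add: expect_const field_simps)

  let ?a = "\<lambda>S. if S \<subseteq> J then \<theta> * 2 ^ d else 0"
  let ?b = "\<lambda>S. if S \<subseteq> J then 0 else (cZ S)\<^sup>2"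
  have bound: "c S * cZ S \<le> ?a S + 1 / 2 * (c S)\<^sup>2 + 1 / 2 * ?b S" if "S \<in> H" for S
  proof (cases "S \<subseteq> J")
    case True
    have "\<bar>cZ S\<bar> \<le> 2 ^ card S"
      unfolding cZ_def using assms(1,4) that by (intro abs_coef_le) auto
    also have "\<dots> \<le> 2 ^ d" using assms(4)[OF that] by (intro power_increasing) auto
    finally have "\<bar>c S\<bar> * \<bar>cZ S\<bar> \<le> \<theta> * 2 ^ d"
      using assms(4)[OF that] assms(2) by (intro mult_mono) auto
    then have "c S * cZ S \<le> \<theta> * 2 ^ d" unfolding abs_mult[symmetric] by linarith
    then show ?thesis using True by (simp add: add_increasing2)
  next
    case False
    then show ?thesis using sum_squares_bound[of "c S" "cZ S"] by simp
  qed
  have "(\<Sum>S\<in>H. ?a S) = card {S\<in>H. S \<subseteq> J} * (\<theta> * 2 ^ d)"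
    using finH by (simp add: sum.inter_filter[symmetric])
  also have "\<dots> \<le> (d / t ^ 3 + 1) ^ d * (\<theta> * 2 ^ d)"
  proof (intro mult_right_mono)
    have "card {S\<in>H. S \<subseteq> J} \<le> card {S. S \<subseteq> J \<and> card S \<le> d}"
      using finJ assms(4) by (intro card_mono) auto
    also have "\<dots> \<le> (card J + 1) ^ d" by (rule card_small_subsets_le[OF finJ(1)])
    finally have "real (card {S\<in>H. S \<subseteq> J}) \<le> real ((card J + 1) ^ d)" by (rule of_nat_mono)
    also have "\<dots> = (real (card J) + 1) ^ d" by (simp add: add.commute)
    also have "\<dots> \<le> (d / t ^ 3 + 1) ^ d" using cardJ by (intro power_mono) auto
    finally show "real (card {S\<in>H. S \<subseteq> J}) \<le> (d / t ^ 3 + 1) ^ d" .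
  qed (use assms(2) in simp)
  finally have a: "(\<Sum>S\<in>H. ?a S) \<le> \<theta> * 2 ^ d * (d / t ^ 3 + 1) ^ d" by (simp add: mult_ac)
  \<comment> \<open>The factor \<open>4 ^ d\<close> undoes the division by
    \<open>4 ^ card S\<close>, and a set not inside \<open>J\<close> meets \<open>Z - J\<close> in
    at least one element.\<close>
  have "(\<Sum>S\<in>H. ?b S) \<le> (\<Sum>S\<in>H. 4 ^ d * (card ((Z - J) \<inter> S) * ((cZ S)\<^sup>2 / 4 ^ card S)))"
  proof (intro sum_mono)
    fix S assume S: "S \<in> H"
    show "?b S \<le> 4 ^ d * (card ((Z - J) \<inter> S) * ((cZ S)\<^sup>2 / 4 ^ card S))"
    proof (cases "S \<subseteq> J")
      case False
      have "finite ((Z - J) \<inter> S)" "(Z - J) \<inter> S \<noteq> {}" using False assms(1) assms(4)[OF S] by auto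
      then have "0 < card ((Z - J) \<inter> S)" by (simp add: card_gt_0_iff)
      then have "1 \<le> real (card ((Z - J) \<inter> S))" by simp
      moreover have "(1::real) \<le> 4 ^ d / 4 ^ card S"
        using assms(4)[OF S] by (simp add: power_increasing)
      ultimately have "1 * 1 * (cZ S)\<^sup>2 \<le> 4 ^ d / 4 ^ card S * card ((Z - J) \<inter> S) * (cZ S)\<^sup>2"
        by (intro mult_right_mono mult_mono) auto
      then show ?thesis using False by (simp add: field_simps)
    qed simp
  qed
  also have "\<dots> \<le> (\<Sum>S | S \<subseteq> Z \<and> card S \<le> d. 4 ^ d * (card ((Z - J) \<inter> S) * ((cZ S)\<^sup>2 / 4 ^ card S)))"
    using assms(1,4) by (intro sum_mono2) auto
  also have "\<dots> = 4 ^ d * (\<Sum>i\<in>Z - J. v i)"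
    using assms(1) by (simp add: swap sum_distrib_left)
  also have "\<dots> \<le> 4 ^ d * (\<Sum>i\<in>Z - J. 3 ^ d * t * influence (1 / 2) Z F i)"
  proof (intro mult_left_mono sum_mono)
    fix i assume i: "i \<in> Z - J"
    then have "v i \<le> t ^ 3" by (auto simp: J_def)
    then show "v i \<le> 3 ^ d * t * influence (1 / 2) Z F i"
      using low_degree_weight_le[OF assms(1), of i t F d] i assms(3) unfolding v_def cZ_def by auto
  qed simp
  also have "\<dots> \<le> 4 ^ d * (\<Sum>i\<in>Z. 3 ^ d * t * influence (1 / 2) Z F i)"
    using assms(1,3) by (intro mult_left_mono sum_mono2) (auto simp: influence_def intro!: mult_nonneg_nonneg expect_nonneg)
  also have "\<dots> = 12 ^ d * t * (\<Sum>i\<in>Z. influence (1 / 2) Z F i)"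
  proof -
    have "(12::real) ^ d = 4 ^ d * 3 ^ d" by (simp add: power_mult_distrib[symmetric])
    then show ?thesis by (simp add: sum_distrib_left mult_ac)
  qed
  finally have b: "(\<Sum>S\<in>H. ?b S) \<le> 12 ^ d * t * (\<Sum>i\<in>Z. influence (1 / 2) Z F i)" .
  have "(\<Sum>S\<in>H. c S * cZ S) \<le> (\<Sum>S\<in>H. ?a S + 1 / 2 * (c S)\<^sup>2 + 1 / 2 * ?b S)"
    by (intro sum_mono bound)
  also have "\<dots> = (\<Sum>S\<in>H. ?a S) + 1 / 2 * (\<Sum>S\<in>H. (c S)\<^sup>2) + 1 / 2 * (\<Sum>S\<in>H. ?b S)"
    by (simp only: sum.distrib sum_distrib_left)
  finally show ?thesis using a b by linarith
qed

text \<open>In each \<open>(2 * p) ^ card S * (c S)\<^sup>2\<close>, one factor \<open>c S\<close>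
  together with the power becomes a mean of restricted coefficients over \<open>Z\<close>. The bound
  for fixed \<open>Z\<close> is then averaged; \<open>p \<le> 1 / 2\<close> makes
  \<open>2 * p\<close> a probability.\<close>

lemma small_coef_mass:
  fixes F :: "'a set \<Rightarrow> bool"
  assumes "finite A" "0 < p" "p \<le> 1 / 2" "0 \<le> \<theta>" "0 < t"
  defines "c \<equiv> coef p A (\<lambda>X. of_bool (F X))"
  shows "(\<Sum>S | S \<subseteq> A \<and> card S \<le> d \<and> \<bar>c S\<bar> < \<theta>. (2 * p) ^ card S * (c S)\<^sup>2)
    \<le> 2 * \<theta> * 2 ^ d * (d / t ^ 3 + 1) ^ d + 12 ^ d * t * (\<Sum>i\<in>A. 2 * p * influence p A F i)"
proof -
  define H where "H = {S. S \<subseteq> A \<and> card S \<le> d \<and> \<bar>c S\<bar> < \<theta>}"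
  define Q where "Q = (\<Sum>S\<in>H. (2 * p) ^ card S * (c S)\<^sup>2)"
  define K where "K = \<theta> * 2 ^ d * (d / t ^ 3 + 1) ^ d"
  define cZ where "cZ Z = coef (1 / 2) Z (\<lambda>X. of_bool (F X) :: real)" for Z
  have fin: "finite Z" if "Z \<subseteq> A" for Z using that assms(1) finite_subset by auto
  have finH: "finite H" unfolding H_def using assms(1) by auto
  have "Q = (\<Sum>S\<in>H. c S * expect (2 * p) A (\<lambda>Z. if S \<subseteq> Z then cZ Z S else 0))"
    unfolding Q_def cZ_def
    by (intro sum.cong refl, subst expect_restriction_coef)
       (use assms in \<open>auto simp: H_def power2_eq_square\<close>)
  also have "\<dots> = expect (2 * p) A (\<lambda>Z. \<Sum>S\<in>H. c S * (if S \<subseteq> Z then cZ Z S else 0))"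
    by (simp only: expect_sum expect_cmult)
  also have "\<dots> \<le> expect (2 * p) A (\<lambda>Z. K + 1 / 2 * (\<Sum>S\<in>H. of_bool (S \<subseteq> Z) * (c S)\<^sup>2)
      + 1 / 2 * 12 ^ d * t * (\<Sum>i\<in>A. if i \<in> Z then influence (1 / 2) Z F i else 0))"
  proof (intro expect_mono)
    fix Z assume Z: "Z \<subseteq> A"
    have "(\<Sum>S\<in>H. c S * (if S \<subseteq> Z then cZ Z S else 0)) = (\<Sum>S\<in>{S\<in>H. S \<subseteq> Z}. c S * cZ Z S)"
      using finH by (simp add: sum.inter_filter if_distrib cong: if_cong)
    moreover have "(\<Sum>S\<in>H. of_bool (S \<subseteq> Z) * (c S)\<^sup>2) = (\<Sum>S\<in>{S\<in>H. S \<subseteq> Z}. (c S)\<^sup>2)"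
      unfolding sum.inter_filter[OF finH] by (intro sum.cong) auto
    moreover have "(\<Sum>i\<in>A. if i \<in> Z then influence (1 / 2) Z F i else 0) = (\<Sum>i\<in>Z. influence (1 / 2) Z F i)"
      using Z assms(1) by (simp add: sum.inter_restrict[symmetric] Int_absorb1)
    ultimately show "(\<Sum>S\<in>H. c S * (if S \<subseteq> Z then cZ Z S else 0)) \<le>
      K + 1 / 2 * (\<Sum>S\<in>H. of_bool (S \<subseteq> Z) * (c S)\<^sup>2)
      + 1 / 2 * 12 ^ d * t * (\<Sum>i\<in>A. if i \<in> Z then influence (1 / 2) Z F i else 0)"
      using small_coef_mass_restricted[OF fin[OF Z] assms(4,5), of "{S\<in>H. S \<subseteq> Z}" d c F]
      unfolding K_def cZ_def by (force simp: H_def)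
  qed (use assms in auto)
  also have "\<dots> = K + 1 / 2 * Q + 1 / 2 * 12 ^ d * t * (\<Sum>i\<in>A. 2 * p * influence p A F i)"
  proof -
    have "(\<Sum>S\<in>H. expect (2 * p) A (\<lambda>Z. of_bool (S \<subseteq> Z)) * (c S)\<^sup>2) = Q"
      unfolding Q_def by (intro sum.cong refl) (use assms(1) in \<open>auto simp: H_def expect_contains\<close>)
    moreover have "(\<Sum>i\<in>A. expect (2 * p) A (\<lambda>Z. if i \<in> Z then influence (1 / 2) Z F i else 0))
      = (\<Sum>i\<in>A. 2 * p * influence p A F i)"
      by (intro sum.cong refl influence_restriction assms(1))
    ultimately show ?thesis
      by (simp only: expect_add expect_cmult expect_multc expect_sum expect_const[OF assms(1)])
  qed
  \<comment> \<open>The squares in the bound for fixed \<open>Z\<close> average to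
    \<open>1 / 2 * Q\<close> and are absorbed into the left-hand side.\<close>
  finally have "Q \<le> 2 * K + 12 ^ d * t * (\<Sum>i\<in>A. 2 * p * influence p A F i)" by simp
  then show ?thesis unfolding Q_def H_def K_def by (simp add: mult_ac)
qed

subsection \<open>Harris inequality and approximation by cores\<close>

text \<open>The influence of \<open>i\<close> is the second moment of the derivative in direction
  \<open>i\<close>, so \<open>p * (1 - p)\<close> times it is the weight of all \<open>S\<close>
  containing \<open>i\<close>. Summing over \<open>i\<close> counts each \<open>S\<close> exactly
  \<open>card S\<close> times.\<close>

lemma degree_weighted_Parseval:
  fixes F :: "'a set \<Rightarrow> bool"
  assumes "finite A" "0 < p" "p < 1"
  shows "(\<Sum>S\<in>Pow A. card S * ((coef p A (\<lambda>X. of_bool (F X)) S)\<^sup>2 * (p * (1 - p)) ^ card S))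
    = (\<Sum>i\<in>A. p * (1 - p) * influence p A F i)"
proof -
  let ?c = "coef p A (\<lambda>X. of_bool (F X))"
  let ?w = "\<lambda>S. (?c S)\<^sup>2 * (p * (1 - p)) ^ card S"
  have inf: "p * (1 - p) * influence p A F i = (\<Sum>S\<in>Pow A. if i \<in> S then ?w S else 0)" if i: "i \<in> A" for i
  proof -
    have fin: "finite T" "i \<notin> T" if "T \<subseteq> A - {i}" for T
      using that assms(1) finite_subset by auto
    have "influence p A F i
        = expect p A (\<lambda>X. (\<Sum>S\<in>Pow A. (if i \<in> S then 0 else ?c (insert i S)) * psi p S X)\<^sup>2)"
      unfolding influence_def
    proof (intro expect_cong)
      fix X assume "X \<subseteq> A"
      then show "of_bool (F (insert i X) \<noteq> F (X - {i}))
          = (\<Sum>S\<in>Pow A. (if i \<in> S then 0 else ?c (insert i S)) * psi p S X)\<^sup>2"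
        by (subst discrete_derivative[OF assms _ i, symmetric]) auto
    qed
    also have "\<dots> = (\<Sum>S\<in>Pow A. (if i \<in> S then 0 else ?c (insert i S))\<^sup>2 * (p * (1 - p)) ^ card S)"
      by (rule expect_psi_square[OF assms(1)])
    also have "\<dots> = (\<Sum>S\<in>Pow (A - {i}). (?c (insert i S))\<^sup>2 * (p * (1 - p)) ^ card S)"
    proof -
      have "(\<Sum>S\<in>Pow (A - {i}). (if i \<in> S then 0 else ?c (insert i S))\<^sup>2 * (p * (1 - p)) ^ card S)
        = (\<Sum>S\<in>Pow (A - {i}). (?c (insert i S))\<^sup>2 * (p * (1 - p)) ^ card S)"
        by (intro sum.cong) auto
      then show ?thesis unfolding sum_Pow_remove[OF assms(1) i] by simp
    qed
    finally have "p * (1 - p) * influence p A F i = (\<Sum>S\<in>Pow (A - {i}). ?w (insert i S))"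
      by (simp add: sum_distrib_left fin mult_ac cong: sum.cong_simp)
    also have "\<dots> = (\<Sum>S\<in>Pow A. if i \<in> S then ?w S else 0)"
    proof -
      have "(\<Sum>S\<in>Pow (A - {i}). if i \<in> S then ?w S else 0) = 0"
        by (intro sum.neutral) auto
      then show ?thesis unfolding sum_Pow_remove[OF assms(1) i] by simp
    qed
    finally show ?thesis .
  qed
  have "(\<Sum>i\<in>A. p * (1 - p) * influence p A F i) = (\<Sum>i\<in>A. \<Sum>S\<in>Pow A. if i \<in> S then ?w S else 0)"
    by (intro sum.cong refl inf)
  also have "\<dots> = (\<Sum>S\<in>Pow A. \<Sum>i\<in>A. if i \<in> S then ?w S else 0)" by (rule sum.swap)
  also have "\<dots> = (\<Sum>S\<in>Pow A. card S * ?w S)"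
  proof (intro sum.cong refl)
    fix S assume "S \<in> Pow A"
    then have "A \<inter> S = S" by auto
    then show "(\<Sum>i\<in>A. if i \<in> S then ?w S else 0) = card S * ?w S"
      using assms(1) by (simp add: sum.If_cases)
  qed
  finally show ?thesis by simp
qed

text \<open>Induction on the ground set: the conditional means of \<open>f\<close> and
  \<open>g\<close> given one coordinate are oppositely ordered, and Chebyshev's inequality on a
  two-point space completes the step.\<close>

lemma Harris:
  assumes "finite A" "0 \<le> p" "p \<le> 1"
    and "\<And>X Y. X \<subseteq> Y \<Longrightarrow> Y \<subseteq> A \<Longrightarrow> f X \<le> f Y"
    and "\<And>X Y. X \<subseteq> Y \<Longrightarrow> Y \<subseteq> A \<Longrightarrow> g Y \<le> g X"
  shows "expect p A (\<lambda>X. f X * g X) \<le> expect p A f * expect p A g"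
  using assms(1,4,5)
proof (induction A arbitrary: f g)
  case (insert i A)
  have mono: "f X \<le> f Y" "g Y \<le> g X" if "X \<subseteq> Y" "Y \<subseteq> insert i A" for X Y
    using insert.prems that by auto
  define a1 b1 a0 b0 where "a1 = expect p A (\<lambda>X. f (insert i X))" "b1 = expect p A (\<lambda>X. g (insert i X))"
    and "a0 = expect p A f" "b0 = expect p A g"
  note ab = this
  have "a0 \<le> a1" "b1 \<le> b0"
    unfolding ab by (intro expect_mono assms(2,3) mono; auto)+
  have "expect p A (\<lambda>X. f (insert i X) * g (insert i X)) \<le> a1 * b1" "expect p A (\<lambda>X. f X * g X) \<le> a0 * b0"
    unfolding ab by (intro insert.IH mono; auto)+
  then have "expect p (insert i A) (\<lambda>X. f X * g X) \<le> p * (a1 * b1) + (1 - p) * (a0 * b0)"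
    unfolding expect_insert[OF insert.hyps] using assms(2,3) by (intro add_mono mult_left_mono) auto
  also have "\<dots> \<le> (p * a1 + (1 - p) * a0) * (p * b1 + (1 - p) * b0)"
  proof -
    have "0 \<le> p * (1 - p) * ((a1 - a0) * (b0 - b1))"
      using assms(2,3) \<open>a0 \<le> a1\<close> \<open>b1 \<le> b0\<close> by (intro mult_nonneg_nonneg) auto
    also have "\<dots> = (p * a1 + (1 - p) * a0) * (p * b1 + (1 - p) * b0) - (p * (a1 * b1) + (1 - p) * (a0 * b0))"
      by (simp add: algebra_simps)
    finally show ?thesis by simp
  qed
  also have "\<dots> = expect p (insert i A) f * expect p (insert i A) g"
    unfolding expect_insert[OF insert.hyps] ab ..
  finally show ?case .
qed simp

section \<open>Cores of a set family\<close>

definition core :: "'a set set \<Rightarrow> 'a set \<Rightarrow> 'a set" where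
  "core \<T> X = \<Union>{T \<in> \<T>. T \<subseteq> X}"

lemma core_subset: "core \<T> X \<subseteq> X"
  by (auto simp: core_def)

lemma core_mono: "X \<subseteq> Y \<Longrightarrow> core \<T> X \<subseteq> core \<T> Y"
  by (auto simp: core_def)

lemma core_core: "core \<T> (core \<T> X) = core \<T> X"
  by (auto simp: core_def)

lemma member_subset_core: "T \<in> \<T> \<Longrightarrow> T \<subseteq> X \<Longrightarrow> T \<subseteq> core \<T> X"
  by (auto simp: core_def)

text \<open>
  Given \<open>core \<T> X = U\<close>, the set \<open>X\<close> is conditioned on \<open>U \<subseteq> X\<close> and on a decreasing event, so
  by the Harris inequality \<open>F\<close> is at most as likely as given \<open>U \<subseteq> X\<close> alone.
\<close>

lemma boosting_core:
  fixes F :: "'a set \<Rightarrow> bool"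
  assumes "finite A" "0 \<le> p" "p \<le> 1" "0 < \<delta>" "\<delta> < 1"
    and F: "\<And>X Y. X \<subseteq> Y \<Longrightarrow> Y \<subseteq> A \<Longrightarrow> F X \<Longrightarrow> F Y"
  defines "bad \<equiv> \<lambda>U. expect p (A - U) (\<lambda>Y. of_bool (F (U \<union> Y))) < 1 - \<delta>"
  shows "\<delta> * expect p A (\<lambda>X. of_bool (F X \<and> bad (core \<T> X))) \<le> expect p A (\<lambda>X. (of_bool (F X) - G (core \<T> X))\<^sup>2)"
proof -
  let ?C = "core \<T>"
  \<comment> \<open>The subsets of \<open>A\<close> are partitioned by their core, and the claim is
    proved on each class.\<close>
  have split: "expect p A \<phi> = (\<Sum>U\<in>?C ` Pow A. expect p A (\<lambda>X. of_bool (?C X = U) * \<phi> X))" for \<phi>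
  proof -
    have "(\<Sum>U\<in>?C ` Pow A. of_bool (?C X = U) * \<phi> X) = \<phi> X" if "X \<subseteq> A" for X
    proof -
      have "(\<Sum>U\<in>?C ` Pow A. of_bool (?C X = U) * \<phi> X) = (\<Sum>U\<in>?C ` Pow A. if ?C X = U then \<phi> X else 0)"
        by (intro sum.cong) auto
      then show ?thesis using that assms(1) by simp
    qed
    then have "expect p A \<phi> = expect p A (\<lambda>X. \<Sum>U\<in>?C ` Pow A. of_bool (?C X = U) * \<phi> X)"
      by (intro expect_cong) simp
    then show ?thesis by (simp only: expect_sum)
  qed
  have "\<delta> * expect p A (\<lambda>X. of_bool (?C X = U) * of_bool (F X \<and> bad (?C X)))
      \<le> expect p A (\<lambda>X. of_bool (?C X = U) * (of_bool (F X) - G (?C X))\<^sup>2)" if U: "U \<in> ?C ` Pow A" for U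
  proof (cases "bad U")
    case False
    have "expect p A (\<lambda>X. of_bool (?C X = U) * of_bool (F X \<and> bad (?C X))) = expect p A (\<lambda>X. 0)"
      by (intro expect_cong) (use False in auto)
    then show ?thesis
      using assms by (simp add: expect_const) (intro expect_nonneg, auto)
  next
    case True
    obtain X0 where X0: "X0 \<subseteq> A" "U = ?C X0" using U by auto
    then have UA: "U \<subseteq> A" using core_subset[of \<T> X0] by auto
    have CU: "?C U = U" using X0 by (simp add: core_core)
    \<comment> \<open>The core lies inside \<open>X\<close>, so fixing it to \<open>U\<close>
      includes the condition \<open>U \<subseteq> X\<close>.\<close>
    have cond: "expect p A (\<lambda>X. of_bool (?C X = U) * \<phi> X)
        = p ^ card U * expect p (A - U) (\<lambda>Y. of_bool (?C (U \<union> Y) = U) * \<phi> (U \<union> Y))" for \<phi>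
    proof -
      have "expect p A (\<lambda>X. of_bool (?C X = U) * \<phi> X) = expect p A (\<lambda>X. of_bool (U \<subseteq> X) * (of_bool (?C X = U) * \<phi> X))"
        using core_subset by (intro expect_cong) fastforce
      then show ?thesis unfolding expect_superset[OF assms(1) UA] .
    qed
    define g where "g Y = (of_bool (?C (U \<union> Y) = U) :: real)" for Y
    define h where "h Y = (of_bool (F (U \<union> Y)) :: real)" for Y
    define m where "m = expect p (A - U) g"
    define m1 where "m1 = expect p (A - U) (\<lambda>Y. h Y * g Y)"
    define \<gamma> where "\<gamma> = G U"
    \<comment> \<open>Having core \<open>U\<close> is a decreasing event: the core of
      \<open>U \<union> Y\<close> always contains \<open>U\<close> and can only grow with
      \<open>Y\<close>.\<close>
    have g_anti: "g Y' \<le> g Y" if "Y \<subseteq> Y'" for Y Y'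
    proof -
      have "U \<subseteq> ?C (U \<union> Y)" "?C (U \<union> Y) \<subseteq> ?C (U \<union> Y')"
        using core_mono[of U "U \<union> Y" \<T>] core_mono[of "U \<union> Y" "U \<union> Y'" \<T>] CU that by auto
      then show ?thesis by (auto simp: g_def)
    qed
    have "m1 \<le> expect p (A - U) h * m"
      unfolding m1_def m_def
    proof (intro Harris)
      fix X Y assume XY: "X \<subseteq> Y" "Y \<subseteq> A - U"
      then have "U \<union> X \<subseteq> U \<union> Y" "U \<union> Y \<subseteq> A" using UA by auto
      then show "h X \<le> h Y" using F[of "U \<union> X" "U \<union> Y"] by (auto simp: h_def)
      show "g Y \<le> g X" using XY by (rule_tac g_anti)
    qed (use assms in auto)
    also have "\<dots> \<le> (1 - \<delta>) * m"
      using True unfolding bad_def h_def m_def g_def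
      by (intro mult_right_mono expect_nonneg) (use assms in auto)
    finally have m1_le: "m1 \<le> (1 - \<delta>) * m" .
    have m1_nonneg: "0 \<le> m1"
      unfolding m1_def g_def h_def by (intro expect_nonneg) (use assms in auto)
    \<comment> \<open>The best constant on this class has squared error
      \<open>m1 * (m - m1) / m\<close>, which is at least \<open>\<delta> * m1\<close>. Completing
      the square at \<open>\<gamma> = 1 - \<delta>\<close> gives the bound for every
      \<open>\<gamma>\<close> without dividing by \<open>m\<close>.\<close>
    have "m1 * ((1 - \<delta>) * (1 - \<gamma>)\<^sup>2 + \<delta> * \<gamma>\<^sup>2) = m1 * (\<delta> * (1 - \<delta>)) + m1 * (\<gamma> - (1 - \<delta>))\<^sup>2"
      by (simp add: power2_eq_square algebra_simps)
    then have "m1 * (\<delta> * (1 - \<delta>)) \<le> (1 - \<delta>) * (m1 * (1 - \<gamma>)\<^sup>2) + \<gamma>\<^sup>2 * (\<delta> * m1)"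
      using m1_nonneg by (simp add: algebra_simps)
    also have "\<dots> \<le> (1 - \<delta>) * (m1 * (1 - \<gamma>)\<^sup>2) + \<gamma>\<^sup>2 * ((1 - \<delta>) * (m - m1))"
      using m1_le by (intro add_left_mono mult_left_mono) (auto simp: algebra_simps)
    finally have "(1 - \<delta>) * (\<delta> * m1) \<le> (1 - \<delta>) * (m1 * (1 - \<gamma>)\<^sup>2 + (m - m1) * \<gamma>\<^sup>2)"
      by (simp add: algebra_simps)
    then have *: "\<delta> * m1 \<le> m1 * (1 - \<gamma>)\<^sup>2 + (m - m1) * \<gamma>\<^sup>2"
      using assms(5) by simp
    have "expect p (A - U) (\<lambda>Y. of_bool (?C (U \<union> Y) = U) * of_bool (F (U \<union> Y) \<and> bad (?C (U \<union> Y)))) = m1"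
      unfolding m1_def g_def h_def by (intro expect_cong) (use True in auto)
    moreover have "expect p (A - U) (\<lambda>Y. of_bool (?C (U \<union> Y) = U) * (of_bool (F (U \<union> Y)) - G (?C (U \<union> Y)))\<^sup>2)
      = m1 * (1 - \<gamma>)\<^sup>2 + (m - m1) * \<gamma>\<^sup>2"
      unfolding m1_def m_def expect_diff[symmetric] expect_multc[symmetric] expect_add[symmetric]
      by (intro expect_cong) (auto simp: g_def h_def \<gamma>_def)
    moreover have "\<delta> * (p ^ card U * m1) \<le> p ^ card U * (m1 * (1 - \<gamma>)\<^sup>2 + (m - m1) * \<gamma>\<^sup>2)"
      unfolding mult.left_commute[of \<delta>] by (intro mult_left_mono *) (use assms(2) in simp)
    ultimately show ?thesis
      unfolding cond by simp
  qed
  then show ?thesis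
    unfolding split[of "\<lambda>X. of_bool (F X \<and> bad (?C X))"] split[of "\<lambda>X. (of_bool (F X) - G (?C X))\<^sup>2"]
      sum_distrib_left by (intro sum_mono)
qed

section \<open>Change of basis between characters and indicators of containment\<close>

lemma psi_eq_sum_contains:
  assumes "finite S"
  shows "psi p S X = (\<Sum>R\<in>Pow S. (- p) ^ card (S - R) * of_bool (R \<subseteq> X))"
proof -
  have "psi p S X = (\<Prod>i\<in>S. of_bool (i \<in> X) + (- p))" by (simp add: psi_def)
  also have "\<dots> = (\<Sum>R\<in>Pow S. (\<Prod>i\<in>R. of_bool (i \<in> X)) * (\<Prod>i\<in>S - R. - p))"
    by (rule prod_add[OF assms])
  also have "\<dots> = (\<Sum>R\<in>Pow S. (- p) ^ card (S - R) * of_bool (R \<subseteq> X))"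
  proof (intro sum.cong refl)
    fix R assume "R \<in> Pow S"
    then have "finite R" using assms finite_subset by auto
    then have "(\<Prod>i\<in>R. of_bool (i \<in> X)) = (of_bool (R \<subseteq> X) :: real)" by (induction R) auto
    then show "(\<Prod>i\<in>R. of_bool (i \<in> X)) * (\<Prod>i\<in>S - R. - p) = (- p) ^ card (S - R) * of_bool (R \<subseteq> X)"
      by simp
  qed
  finally show ?thesis .
qed

lemma contains_eq_sum_psi:
  assumes "finite R"
  shows "of_bool (R \<subseteq> X) = (\<Sum>V\<in>Pow R. p ^ card (R - V) * psi p V X)"
proof -
  have "of_bool (R \<subseteq> X) = (\<Prod>i\<in>R. (of_bool (i \<in> X) - p) + p)"
    using assms by (induction R) auto
  also have "\<dots> = (\<Sum>V\<in>Pow R. (\<Prod>i\<in>V. of_bool (i \<in> X) - p) * (\<Prod>i\<in>R - V. p))"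
    by (rule prod_add[OF assms])
  finally show ?thesis by (simp add: psi_def mult.commute)
qed

text \<open>\<open>N R\<close> is the expected number of members of \<open>H\<close> that extend
  \<open>R\<close> and lie in \<open>X\<close>, given \<open>R \<subseteq> X\<close>. The sum of
  \<open>p ^ card R * N R\<close> is \<open>M\<close>, so Markov's inequality makes
  \<open>\<T>\<close> sparse. For the approximation, the indicator of \<open>R \<subseteq> X\<close>
  is replaced by its conditional mean given the part of \<open>X\<close> in the core of
  \<open>R\<close>. The error then has no character \<open>V\<close> from \<open>\<T>\<close>, and
  elsewhere \<open>N V \<le> L\<close> keeps the coefficient small.\<close>

lemma core_approximation:
  fixes c :: "'a set \<Rightarrow> real" and d :: nat
  assumes "finite A" "0 < p" "p \<le> 1 / 2" "0 < L"
    and H: "\<And>S. S \<in> H \<Longrightarrow> S \<subseteq> A \<and> card S \<le> d \<and> \<bar>c S\<bar> \<le> 2 ^ d"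
  defines "N \<equiv> \<lambda>R. \<Sum>S\<in>H. if R \<subseteq> S then p ^ card (S - R) else 0"
  defines "\<T> \<equiv> {R. R \<subseteq> A \<and> card R \<le> d \<and> L \<le> N R}"
  defines "M \<equiv> \<Sum>S\<in>H. (2 * p) ^ card S"
  shows "(\<Sum>R\<in>\<T>. p ^ card R) \<le> M / L"
    and "\<exists>G. expect p A (\<lambda>X. ((\<Sum>S\<in>H. c S * psi p S X) - G (core \<T> X))\<^sup>2) \<le> 16 ^ d * L * M"
proof -
  have finH: "finite H" by (rule finite_subset[of _ "Pow A"]) (use assms(1) H in auto)
  have fin: "finite S" if "S \<subseteq> A" for S using that assms(1) finite_subset by auto
  have N0: "0 \<le> N R" for R unfolding N_def using assms(2) by (intro sum_nonneg) auto
  \<comment> \<open>Each \<open>S\<close> has \<open>2 ^ card S\<close> subsets \<open>R\<close>,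
    and each contributes \<open>p ^ card S\<close>; hence the base \<open>2 * p\<close> in
    \<open>M\<close>.\<close>
  have NM: "(\<Sum>R\<in>Pow A. p ^ card R * N R) = M"
  proof -
    have "(\<Sum>R\<in>Pow A. p ^ card R * N R) = (\<Sum>S\<in>H. \<Sum>R\<in>Pow A. if R \<subseteq> S then p ^ card R * p ^ card (S - R) else 0)"
      unfolding N_def sum_distrib_left by (subst sum.swap, intro sum.cong) auto
    also have "\<dots> = (\<Sum>S\<in>H. \<Sum>R\<in>Pow S. p ^ card S)"
    proof (rule sum.cong[OF refl])
      fix S assume "S \<in> H"
      then have S: "S \<subseteq> A" "finite S" using H fin by auto
      have "(\<Sum>R\<in>Pow A. if R \<subseteq> S then p ^ card R * p ^ card (S - R) else 0)
        = (\<Sum>R\<in>{R \<in> Pow A. R \<subseteq> S}. p ^ card R * p ^ card (S - R))"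
        by (rule sum.inter_filter[symmetric]) (use assms(1) in simp)
      also have "{R \<in> Pow A. R \<subseteq> S} = Pow S" using S by auto
      also have "(\<Sum>R\<in>Pow S. p ^ card R * p ^ card (S - R)) = (\<Sum>R\<in>Pow S. p ^ card S)"
      proof (intro sum.cong refl)
        fix R assume "R \<in> Pow S"
        then have "card R + card (S - R) = card S"
          using S by (metis PowD card_Diff_subset card_mono finite_subset le_add_diff_inverse)
        then show "p ^ card R * p ^ card (S - R) = p ^ card S" by (metis power_add)
      qed
      finally show "(\<Sum>R\<in>Pow A. if R \<subseteq> S then p ^ card R * p ^ card (S - R) else 0) = (\<Sum>R\<in>Pow S. p ^ card S)" .
    qed
    also have "\<dots> = M"
      unfolding M_def by (intro sum.cong refl) (use H fin in \<open>auto simp: card_Pow power_mult_distrib\<close>)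
    finally show ?thesis .
  qed
  have "L * (\<Sum>R\<in>\<T>. p ^ card R) \<le> (\<Sum>R\<in>\<T>. p ^ card R * N R)"
    unfolding sum_distrib_left
    by (intro sum_mono) (use assms(2) in \<open>auto simp: \<T>_def mult.commute intro!: mult_left_mono\<close>)
  also have "\<dots> \<le> (\<Sum>R\<in>Pow A. p ^ card R * N R)"
    by (intro sum_mono2) (use assms(1,2) N0 in \<open>auto simp: \<T>_def\<close>)
  finally show "(\<Sum>R\<in>\<T>. p ^ card R) \<le> M / L"
    unfolding NM using assms(4) by (simp add: field_simps)

  define C where "C = core \<T>"
  \<comment> \<open>Coefficients of the truncated expansion with respect to the indicators of
    \<open>R \<subseteq> X\<close>.\<close>
  define e where "e R = (\<Sum>S\<in>H. if R \<subseteq> S then c S * (- p) ^ card (S - R) else 0)" for R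
  define G where "G W = (\<Sum>R\<in>Pow A. e R * (p ^ card (R - C R) * of_bool (C R \<subseteq> W)))" for W
  \<comment> \<open>Character coefficients of the error: passing to the conditional mean removes
    exactly the characters with \<open>V \<subseteq> C R\<close> from the expansion of the
    indicator.\<close>
  define D where "D V = (\<Sum>R\<in>Pow A. if V \<subseteq> R \<and> \<not> V \<subseteq> C R then e R * p ^ card (R - V) else 0)" for V
  have Hsum: "(\<Sum>S\<in>H. c S * psi p S X) = (\<Sum>R\<in>Pow A. e R * of_bool (R \<subseteq> X))" for X
  proof -
    have "(\<Sum>R\<in>Pow A. e R * of_bool (R \<subseteq> X))
      = (\<Sum>S\<in>H. \<Sum>R\<in>Pow A. if R \<subseteq> S then c S * ((- p) ^ card (S - R) * of_bool (R \<subseteq> X)) else 0)"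
      unfolding e_def sum_distrib_right by (subst sum.swap, intro sum.cong) auto
    also have "\<dots> = (\<Sum>S\<in>H. c S * psi p S X)"
    proof (intro sum.cong refl)
      fix S assume "S \<in> H"
      then have S: "S \<subseteq> A" "finite S" using H fin by auto
      have "(\<Sum>R\<in>Pow A. if R \<subseteq> S then c S * ((- p) ^ card (S - R) * of_bool (R \<subseteq> X)) else 0)
        = (\<Sum>R\<in>{R \<in> Pow A. R \<subseteq> S}. c S * ((- p) ^ card (S - R) * of_bool (R \<subseteq> X)))"
        by (rule sum.inter_filter[symmetric]) (use assms(1) in simp)
      also have "{R \<in> Pow A. R \<subseteq> S} = Pow S" using S by auto
      finally show "(\<Sum>R\<in>Pow A. if R \<subseteq> S then c S * ((- p) ^ card (S - R) * of_bool (R \<subseteq> X)) else 0)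
        = c S * psi p S X"
        unfolding psi_eq_sum_contains[OF S(2)] sum_distrib_left .
    qed
    finally show ?thesis by simp
  qed
  have diff: "(\<Sum>S\<in>H. c S * psi p S X) - G (C X) = (\<Sum>V\<in>Pow A. D V * psi p V X)" for X
  proof -
    \<comment> \<open>Since the core is idempotent, \<open>G\<close> takes the same value at
      \<open>X\<close> and at \<open>C X\<close>.\<close>
    have "C R \<subseteq> C X \<longleftrightarrow> C R \<subseteq> X" for R
      using core_subset[of \<T> X] core_mono[of "C R" X \<T>] core_core[of \<T> R] unfolding C_def by auto
    then have "(\<Sum>S\<in>H. c S * psi p S X) - G (C X)
      = (\<Sum>R\<in>Pow A. e R * (of_bool (R \<subseteq> X) - p ^ card (R - C R) * of_bool (C R \<subseteq> X)))"
      unfolding Hsum G_def by (simp add: sum_subtractf algebra_simps)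
    also have "\<dots> = (\<Sum>R\<in>Pow A. \<Sum>V\<in>Pow A. if V \<subseteq> R \<and> \<not> V \<subseteq> C R then e R * p ^ card (R - V) * psi p V X else 0)"
    proof (intro sum.cong refl)
      fix R assume "R \<in> Pow A"
      then have R: "R \<subseteq> A" "finite R" using fin by auto
      have CR: "C R \<subseteq> R" "finite (C R)" using core_subset[of \<T> R] R(2) finite_subset unfolding C_def by auto
      have "p ^ card (R - C R) * of_bool (C R \<subseteq> X) = (\<Sum>V\<in>Pow (C R). p ^ card (R - V) * psi p V X)"
        unfolding contains_eq_sum_psi[OF CR(2), of X p] sum_distrib_left
      proof (intro sum.cong refl)
        fix V assume V: "V \<in> Pow (C R)"
        have "card (R - V) = card (R - C R) + card (C R - V)"
        proof -
          have "R - V = (R - C R) \<union> (C R - V)" using V CR by auto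
          moreover have "card ((R - C R) \<union> (C R - V)) = card (R - C R) + card (C R - V)"
            by (rule card_Un_disjoint) (use R CR in auto)
          ultimately show ?thesis by simp
        qed
        then show "p ^ card (R - C R) * (p ^ card (C R - V) * psi p V X) = p ^ card (R - V) * psi p V X"
          by (simp add: power_add)
      qed
      moreover have "of_bool (R \<subseteq> X) = (\<Sum>V\<in>Pow R. p ^ card (R - V) * psi p V X)"
        by (rule contains_eq_sum_psi[OF R(2)])
      moreover have "(\<Sum>V\<in>Pow R. p ^ card (R - V) * psi p V X) - (\<Sum>V\<in>Pow (C R). p ^ card (R - V) * psi p V X)
        = (\<Sum>V\<in>Pow R - Pow (C R). p ^ card (R - V) * psi p V X)"
        by (rule sum_diff[symmetric]) (use R CR in auto)
      moreover have "Pow R - Pow (C R) = {V \<in> Pow A. V \<subseteq> R \<and> \<not> V \<subseteq> C R}" using R by auto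
      moreover have "(\<Sum>V\<in>{V \<in> Pow A. V \<subseteq> R \<and> \<not> V \<subseteq> C R}. e R * p ^ card (R - V) * psi p V X)
        = (\<Sum>V\<in>Pow A. if V \<subseteq> R \<and> \<not> V \<subseteq> C R then e R * p ^ card (R - V) * psi p V X else 0)"
        by (rule sum.inter_filter) (use assms(1) in simp)
      ultimately show "e R * (of_bool (R \<subseteq> X) - p ^ card (R - C R) * of_bool (C R \<subseteq> X))
        = (\<Sum>V\<in>Pow A. if V \<subseteq> R \<and> \<not> V \<subseteq> C R then e R * p ^ card (R - V) * psi p V X else 0)"
        by (simp add: sum_distrib_left mult.assoc)
    qed
    also have "\<dots> = (\<Sum>V\<in>Pow A. D V * psi p V X)"
      unfolding D_def sum_distrib_right by (subst sum.swap, intro sum.cong) auto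
    finally show ?thesis .
  qed
  have D: "\<bar>D V\<bar> \<le> (if V \<in> \<T> then 0 else 4 ^ d * N V)" if V: "V \<subseteq> A" for V
  proof (cases "V \<in> \<T>")
    case True
    \<comment> \<open>A member \<open>V\<close> of \<open>\<T>\<close> with
      \<open>V \<subseteq> R\<close> lies in the core of \<open>R\<close>, so no term
      survives.\<close>
    then have "D V = 0"
      unfolding D_def C_def by (intro sum.neutral) (auto dest: member_subset_core)
    then show ?thesis using True by simp
  next
    case False
    have "\<bar>D V\<bar> \<le> (\<Sum>R\<in>Pow A. if V \<subseteq> R then \<bar>e R\<bar> * p ^ card (R - V) else 0)"
      unfolding D_def by (intro order.trans[OF sum_abs] sum_mono) (use assms(2) in \<open>auto simp: abs_mult\<close>)
    also have "\<dots> \<le> (\<Sum>R\<in>Pow A. \<Sum>S\<in>H. if V \<subseteq> R \<and> R \<subseteq> S then 2 ^ d * p ^ card (S - V) else 0)"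
    proof (intro sum_mono)
      fix R assume "R \<in> Pow A"
      then have R: "R \<subseteq> A" by simp
      show "(if V \<subseteq> R then \<bar>e R\<bar> * p ^ card (R - V) else 0)
        \<le> (\<Sum>S\<in>H. if V \<subseteq> R \<and> R \<subseteq> S then 2 ^ d * p ^ card (S - V) else 0)"
      proof (cases "V \<subseteq> R")
        case True
        have "\<bar>e R\<bar> * p ^ card (R - V) \<le> (\<Sum>S\<in>H. \<bar>if R \<subseteq> S then c S * (- p) ^ card (S - R) else 0\<bar>) * p ^ card (R - V)"
          unfolding e_def by (intro mult_right_mono sum_abs) (use assms(2) in auto)
        also have "\<dots> \<le> (\<Sum>S\<in>H. if R \<subseteq> S then 2 ^ d * p ^ card (S - V) else 0)"
          unfolding sum_distrib_right
        proof (intro sum_mono)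
          fix S assume S: "S \<in> H"
          show "\<bar>if R \<subseteq> S then c S * (- p) ^ card (S - R) else 0\<bar> * p ^ card (R - V)
            \<le> (if R \<subseteq> S then 2 ^ d * p ^ card (S - V) else 0)"
          proof (cases "R \<subseteq> S")
            case RS: True
            have "card (S - V) = card (S - R) + card (R - V)"
            proof -
              have "S - V = (S - R) \<union> (R - V)" using True RS by auto
              moreover have "finite S" "finite R" using S H fin R by auto
              ultimately show ?thesis by (simp add: card_Un_disjoint disjoint_iff)
            qed
            then have "\<bar>c S * (- p) ^ card (S - R)\<bar> * p ^ card (R - V) = \<bar>c S\<bar> * p ^ card (S - V)"
              using assms(2) by (simp add: abs_mult power_abs power_add)
            also have "\<dots> \<le> 2 ^ d * p ^ card (S - V)"
              using H[OF S] assms(2) by (intro mult_right_mono) auto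
            finally show ?thesis using RS by simp
          qed simp
        qed
        finally show ?thesis using True by simp
      qed simp
    qed
    also have "\<dots> = (\<Sum>S\<in>H. \<Sum>R\<in>Pow A. if V \<subseteq> R \<and> R \<subseteq> S then 2 ^ d * p ^ card (S - V) else 0)"
      by (rule sum.swap)
    \<comment> \<open>One \<open>2 ^ d\<close> comes from the coefficient, the other from the number
      of \<open>R\<close> between \<open>V\<close> and \<open>S\<close>.\<close>
    also have "\<dots> \<le> (\<Sum>S\<in>H. 4 ^ d * (if V \<subseteq> S then p ^ card (S - V) else 0))"
    proof (intro sum_mono)
      fix S assume S: "S \<in> H"
      then have S': "S \<subseteq> A" "finite S" "card S \<le> d" using H fin by auto
      have "(\<Sum>R\<in>Pow A. if V \<subseteq> R \<and> R \<subseteq> S then 2 ^ d * p ^ card (S - V) else 0)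
        = (\<Sum>R\<in>{R \<in> Pow A. V \<subseteq> R \<and> R \<subseteq> S}. 2 ^ d * p ^ card (S - V))"
        by (rule sum.inter_filter[symmetric]) (use assms(1) in simp)
      also have "\<dots> = card {R \<in> Pow A. V \<subseteq> R \<and> R \<subseteq> S} * (2 ^ d * p ^ card (S - V))"
        by simp
      also have "\<dots> \<le> (if V \<subseteq> S then 2 ^ d else 0) * (2 ^ d * p ^ card (S - V))"
      proof (intro mult_right_mono)
        show "real (card {R \<in> Pow A. V \<subseteq> R \<and> R \<subseteq> S}) \<le> (if V \<subseteq> S then 2 ^ d else 0)"
        proof (cases "V \<subseteq> S")
          case True
          have "card {R \<in> Pow A. V \<subseteq> R \<and> R \<subseteq> S} \<le> card (Pow S)"
            by (rule card_mono) (use S' in auto)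
          also have "\<dots> = 2 ^ card S" by (rule card_Pow[OF S'(2)])
          also have "\<dots> \<le> 2 ^ d" using S'(3) by (intro power_increasing) auto
          finally have "real (card {R \<in> Pow A. V \<subseteq> R \<and> R \<subseteq> S}) \<le> real (2 ^ d)" by (rule of_nat_mono)
          then show ?thesis using True by simp
        next
          case False
          then have "{R \<in> Pow A. V \<subseteq> R \<and> R \<subseteq> S} = {}" by auto
          then show ?thesis using False by (simp only: card.empty) simp
        qed
      qed (use assms(2) in auto)
      also have "\<dots> = 4 ^ d * (if V \<subseteq> S then p ^ card (S - V) else 0)"
        by (simp add: power_mult_distrib[symmetric])
      finally show "(\<Sum>R\<in>Pow A. if V \<subseteq> R \<and> R \<subseteq> S then 2 ^ d * p ^ card (S - V) else 0)
        \<le> 4 ^ d * (if V \<subseteq> S then p ^ card (S - V) else 0)" .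
    qed
    finally show ?thesis
      using False by (simp add: N_def sum_distrib_left)
  qed
  have NL: "N V \<le> L" if "V \<subseteq> A" "V \<notin> \<T>" for V
  proof (cases "card V \<le> d")
    case True
    then show ?thesis using that by (auto simp: \<T>_def)
  next
    case False
    \<comment> \<open>A set with more than \<open>d\<close> elements has no superset in
      \<open>H\<close>.\<close>
    have "N V = 0"
      unfolding N_def
    proof (intro sum.neutral ballI)
      fix S assume "S \<in> H"
      then have "finite S" "card S \<le> d" using H fin by auto
      then have "\<not> V \<subseteq> S" using False card_mono[of S V] by auto
      then show "(if V \<subseteq> S then p ^ card (S - V) else 0) = 0" by simp
    qed
    then show ?thesis using assms(4) by simp
  qed
  have "expect p A (\<lambda>X. ((\<Sum>S\<in>H. c S * psi p S X) - G (C X))\<^sup>2) = (\<Sum>V\<in>Pow A. (D V)\<^sup>2 * (p * (1 - p)) ^ card V)"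
    unfolding diff by (rule expect_psi_square[OF assms(1)])
  also have "\<dots> \<le> (\<Sum>V\<in>Pow A. 16 ^ d * L * (p ^ card V * N V))"
  proof (intro sum_mono)
    fix V assume V: "V \<in> Pow A"
    have "(D V)\<^sup>2 \<le> 16 ^ d * (L * N V)"
    proof (cases "V \<in> \<T>")
      case True
      then show ?thesis using D[of V] V N0 assms(4) by simp
    next
      case False
      have "(D V)\<^sup>2 \<le> (4 ^ d * N V)\<^sup>2"
        using D[of V] V False N0[of V] by (simp add: abs_le_square_iff[symmetric] del: abs_le_square_iff)
      also have "\<dots> = 16 ^ d * (N V * N V)"
      proof -
        have "(16::real) ^ d = 4 ^ d * 4 ^ d" by (simp add: power_mult_distrib[symmetric])
        then show ?thesis by (simp add: power2_eq_square)
      qed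
      also have "\<dots> \<le> 16 ^ d * (L * N V)"
        using NL[of V] V False N0[of V] by (intro mult_left_mono mult_right_mono) auto
      finally show ?thesis .
    qed
    moreover have "(p * (1 - p)) ^ card V \<le> p ^ card V"
      using assms(2,3) by (intro power_mono) (auto simp: algebra_simps)
    ultimately have "(D V)\<^sup>2 * (p * (1 - p)) ^ card V \<le> 16 ^ d * (L * N V) * p ^ card V"
      by (intro mult_mono) (use assms N0 in auto)
    then show "(D V)\<^sup>2 * (p * (1 - p)) ^ card V \<le> 16 ^ d * L * (p ^ card V * N V)" by (simp add: mult_ac)
  qed
  also have "\<dots> = 16 ^ d * L * M"
    by (simp only: sum_distrib_left[symmetric] NM)
  finally show "\<exists>G. expect p A (\<lambda>X. ((\<Sum>S\<in>H. c S * psi p S X) - G (core \<T> X))\<^sup>2) \<le> 16 ^ d * L * M"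
    unfolding C_def by blast
qed

subsection \<open>Choice of parameters\<close>

lemma expansion_truncation:
  assumes "finite A" "0 < p" "p < 1" "H \<subseteq> Pow A"
  shows "expect p A (\<lambda>X. (f X - (\<Sum>S\<in>H. coef p A f S * psi p S X))\<^sup>2)
    = (\<Sum>S\<in>Pow A - H. (coef p A f S)\<^sup>2 * (p * (1 - p)) ^ card S)"
proof -
  let ?c = "coef p A f"
  have "expect p A (\<lambda>X. (f X - (\<Sum>S\<in>H. ?c S * psi p S X))\<^sup>2)
    = expect p A (\<lambda>X. (\<Sum>S\<in>Pow A. (if S \<in> H then 0 else ?c S) * psi p S X)\<^sup>2)"
  proof (intro expect_cong)
    fix X assume X: "X \<subseteq> A"
    have "f X = (\<Sum>S\<in>H. ?c S * psi p S X) + (\<Sum>S\<in>Pow A - H. ?c S * psi p S X)"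
      unfolding psi_expansion[OF assms(1-3) X, of f]
      using sum.subset_diff[OF assms(4), of "\<lambda>S. ?c S * psi p S X"] assms(1) by simp
    moreover have "(\<Sum>S\<in>Pow A. (if S \<in> H then 0 else ?c S) * psi p S X) = (\<Sum>S\<in>Pow A - H. ?c S * psi p S X)"
      by (rule sum.mono_neutral_cong_right) (use assms(1) in auto)
    ultimately show "(f X - (\<Sum>S\<in>H. ?c S * psi p S X))\<^sup>2
        = (\<Sum>S\<in>Pow A. (if S \<in> H then 0 else ?c S) * psi p S X)\<^sup>2" by simp
  qed
  also have "\<dots> = (\<Sum>S\<in>Pow A. (if S \<in> H then 0 else ?c S)\<^sup>2 * (p * (1 - p)) ^ card S)"
    by (rule expect_psi_square[OF assms(1)])
  also have "\<dots> = (\<Sum>S\<in>Pow A - H. (?c S)\<^sup>2 * (p * (1 - p)) ^ card S)"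
    by (rule sum.mono_neutral_cong_right) (use assms(1) in auto)
  finally show ?thesis .
qed

text \<open>The complement of the boosting event in terms of sets; the conditional mean given
  \<open>S \<subseteq> X\<close> is written with a fresh random subset of
  \<open>A - S\<close>.\<close>

definition no_booster :: "real \<Rightarrow> 'a set \<Rightarrow> ('a set \<Rightarrow> bool) \<Rightarrow> real \<Rightarrow> real \<Rightarrow> 'a set \<Rightarrow> bool" where
  "no_booster p A F \<delta> k X \<longleftrightarrow>
    (\<forall>S \<subseteq> X. real (card S) \<le> k \<longrightarrow> expect p (A - S) (\<lambda>Y. of_bool (F (S \<union> Y))) < 1 - \<delta>)"

text \<open>The core is the candidate booster. Where \<open>F\<close> holds without a booster,
  either the core has at most \<open>k\<close> elements and fails to boost, which
  \<open>boosting_core\<close> makes rare, or it has more than \<open>k\<close> elements, which is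
  rare by Markov's inequality because its mean size is at most \<open>d * W\<close>.\<close>

lemma no_booster_le_core:
  fixes F :: "'a set \<Rightarrow> bool" and d :: nat and W e :: real
  assumes "finite A" "0 < p" "p < 1" "0 < \<delta>" "\<delta> < 1" "0 < k"
    and F: "\<And>X Y. X \<subseteq> Y \<Longrightarrow> Y \<subseteq> A \<Longrightarrow> F X \<Longrightarrow> F Y"
    and T: "\<And>T. T \<in> \<T> \<Longrightarrow> T \<subseteq> A \<and> card T \<le> d"
    and W: "(\<Sum>T\<in>\<T>. p ^ card T) \<le> W"
    and G: "expect p A (\<lambda>X. (of_bool (F X) - G (core \<T> X))\<^sup>2) \<le> e"
  shows "expect p A (\<lambda>X. of_bool (F X \<and> no_booster p A F \<delta> k X)) \<le> e / \<delta> + d * W / k"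
proof -
  define bad where "bad U \<longleftrightarrow> expect p (A - U) (\<lambda>Y. of_bool (F (U \<union> Y))) < 1 - \<delta>" for U
  have finT: "finite \<T>" by (rule finite_subset[of _ "Pow A"]) (use assms(1) T in auto)
  have "expect p A (\<lambda>X. of_bool (F X \<and> no_booster p A F \<delta> k X))
      \<le> expect p A (\<lambda>X. of_bool (F X \<and> bad (core \<T> X)) + 1 / k * (\<Sum>T\<in>\<T>. of_bool (T \<subseteq> X) * real (card T)))"
  proof (intro expect_mono)
    fix X assume "X \<subseteq> A"
    have "card (core \<T> X) \<le> (\<Sum>T\<in>{T \<in> \<T>. T \<subseteq> X}. card T)"
      unfolding core_def using card_Union_le_sum_card by blast
    also have "\<dots> = (\<Sum>T\<in>\<T>. of_bool (T \<subseteq> X) * card T)"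
      unfolding sum.inter_filter[OF finT] by (intro sum.cong) auto
    finally have "real (card (core \<T> X)) \<le> real (\<Sum>T\<in>\<T>. of_bool (T \<subseteq> X) * card T)" by (rule of_nat_mono)
    then have c: "real (card (core \<T> X)) \<le> (\<Sum>T\<in>\<T>. of_bool (T \<subseteq> X) * real (card T))" by simp
    show "of_bool (F X \<and> no_booster p A F \<delta> k X)
        \<le> of_bool (F X \<and> bad (core \<T> X)) + 1 / k * (\<Sum>T\<in>\<T>. of_bool (T \<subseteq> X) * real (card T))"
    proof (cases "real (card (core \<T> X)) \<le> k")
      case True
      then have "no_booster p A F \<delta> k X \<Longrightarrow> bad (core \<T> X)"
        using core_subset[of \<T> X] unfolding no_booster_def bad_def by blast
      moreover have "0 \<le> 1 / k * (\<Sum>T\<in>\<T>. of_bool (T \<subseteq> X) * real (card T))"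
        using assms(6) by (intro mult_nonneg_nonneg sum_nonneg) auto
      ultimately show ?thesis by (auto intro: add_increasing2 add_increasing)
    next
      case False
      then have "1 \<le> 1 / k * (\<Sum>T\<in>\<T>. of_bool (T \<subseteq> X) * real (card T))"
        using c assms(6) by (simp add: field_simps)
      then show ?thesis by (simp add: of_bool_def)
    qed
  qed (use assms in auto)
  also have "\<dots> = expect p A (\<lambda>X. of_bool (F X \<and> bad (core \<T> X))) + 1 / k * (\<Sum>T\<in>\<T>. p ^ card T * card T)"
  proof -
    have "(\<Sum>T\<in>\<T>. expect p A (\<lambda>X. of_bool (T \<subseteq> X)) * real (card T)) = (\<Sum>T\<in>\<T>. p ^ card T * card T)"
      by (intro sum.cong refl) (use T in \<open>simp add: expect_contains[OF assms(1)]\<close>)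
    then show ?thesis by (simp only: expect_add expect_cmult expect_sum expect_multc)
  qed
  also have "\<dots> \<le> e / \<delta> + 1 / k * (d * W)"
  proof (intro add_mono mult_left_mono)
    have "\<delta> * expect p A (\<lambda>X. of_bool (F X \<and> bad (core \<T> X))) \<le> expect p A (\<lambda>X. (of_bool (F X) - G (core \<T> X))\<^sup>2)"
      unfolding bad_def
      by (rule boosting_core[where F = F, OF assms(1) _ _ assms(4,5)]) (use assms(2,3) F in auto)
    then have "\<delta> * expect p A (\<lambda>X. of_bool (F X \<and> bad (core \<T> X))) \<le> e"
      using G by linarith
    then show "expect p A (\<lambda>X. of_bool (F X \<and> bad (core \<T> X))) \<le> e / \<delta>"
      using assms(4) by (simp add: field_simps)
    have "(\<Sum>T\<in>\<T>. p ^ card T * card T) \<le> (\<Sum>T\<in>\<T>. d * p ^ card T)"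
      by (intro sum_mono) (use T assms(2) in \<open>simp add: mult.commute mult_right_mono\<close>)
    also have "\<dots> \<le> d * W" using W by (simp add: sum_distrib_left[symmetric] mult_left_mono)
    finally show "(\<Sum>T\<in>\<T>. p ^ card T * card T) \<le> d * W" .
  qed (use assms(6) in simp)
  finally show ?thesis by simp
qed

text \<open>The squared error has three sources: coefficients below \<open>\<theta>\<close> (the
  first two terms), degrees above \<open>d\<close> (the term \<open>I / (2 * d)\<close>), and the
  passage from the large coefficients to a function of the core. The summand divided by
  \<open>k\<close> is the Markov bound for the size of the core.\<close>

lemma no_booster_parametric:
  fixes F :: "'a set \<Rightarrow> bool" and d :: nat
  assumes "finite A" "0 < p" "p \<le> 1 / 2" "0 < \<delta>" "\<delta> < 1" "0 < k" "0 < \<theta>" "0 < t" "0 < L" "0 < d"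
    and F: "\<And>X Y. X \<subseteq> Y \<Longrightarrow> Y \<subseteq> A \<Longrightarrow> F X \<Longrightarrow> F Y"
  defines "I \<equiv> \<Sum>i\<in>A. 2 * p * (1 - p) * influence p A F i"
  shows "expect p A (\<lambda>X. of_bool (F X \<and> no_booster p A F \<delta> k X))
    \<le> (2 * (2 * \<theta> * 2 ^ d * (d / t ^ 3 + 1) ^ d + 12 ^ d * t * (2 * I) + I / (2 * d)) + 2 * (64 ^ d * L / \<theta>\<^sup>2)) / \<delta>
      + d * (4 ^ d / (\<theta>\<^sup>2 * L)) / k"
proof -
  have p: "0 < p" "p < 1" "0 \<le> p" "p \<le> 1" "0 \<le> p * (1 - p)" using assms(2,3) by auto
  let ?f = "\<lambda>X. of_bool (F X) :: real"
  define c where "c = coef p A ?f"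
  define H where "H = {S. S \<subseteq> A \<and> card S \<le> d \<and> \<theta> \<le> \<bar>c S\<bar>}"
  define K where "K = {S. S \<subseteq> A \<and> card S \<le> d \<and> \<bar>c S\<bar> < \<theta>}"
  define M where "M = (\<Sum>S\<in>H. (2 * p) ^ card S)"
  \<comment> \<open>A member \<open>S\<close> of \<open>H\<close> contributes 1 to its own sum, so
    \<open>\<T>\<close> contains \<open>H\<close> as soon as \<open>L \<le> 1\<close>.\<close>
  define \<T> where "\<T> = {R. R \<subseteq> A \<and> card R \<le> d \<and> L \<le> (\<Sum>S\<in>H. if R \<subseteq> S then p ^ card (S - R) else 0)}"
  have fins: "finite (Pow A)" "H \<subseteq> Pow A" "K \<subseteq> Pow A" "finite K" "finite H"
    using assms(1) by (auto simp: H_def K_def)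
  have p2: "(2 * p) ^ j \<le> 4 ^ j * (p * (1 - p)) ^ j" "(p * (1 - p)) ^ j \<le> (2 * p) ^ j" for j
    unfolding power_mult_distrib[symmetric] using assms(2,3) by (intro power_mono; simp)+
  have cH: "\<bar>c S\<bar> \<le> 2 ^ d" if "S \<in> H" for S
  proof -
    have "\<bar>c S\<bar> \<le> 2 ^ card S"
      unfolding c_def by (rule abs_coef_le) (use that p assms(1) in \<open>auto simp: H_def\<close>)
    also have "\<dots> \<le> 2 ^ d" using that by (intro power_increasing) (auto simp: H_def)
    finally show ?thesis .
  qed
  \<comment> \<open>By Parseval the total weight is at most 1, while each member of \<open>H\<close>
    has squared coefficient at least \<open>\<theta>\<^sup>2\<close>. Replacing \<open>2 * p\<close>
    by \<open>4 * (p * (1 - p))\<close> uses \<open>1 / 2 \<le> 1 - p\<close>.\<close>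
  have "\<theta>\<^sup>2 * M \<le> (\<Sum>S\<in>H. 4 ^ d * ((c S)\<^sup>2 * (p * (1 - p)) ^ card S))"
    unfolding M_def sum_distrib_left
  proof (intro sum_mono)
    fix S assume S: "S \<in> H"
    have "\<theta>\<^sup>2 \<le> (c S)\<^sup>2"
      using S assms(7) by (simp add: H_def abs_le_square_iff[symmetric])
    moreover have "(2 * p) ^ card S \<le> 4 ^ d * (p * (1 - p)) ^ card S"
    proof (rule order.trans[OF p2(1)])
      show "4 ^ card S * (p * (1 - p)) ^ card S \<le> 4 ^ d * (p * (1 - p)) ^ card S"
        using S p(5) by (intro mult_right_mono power_increasing zero_le_power) (auto simp: H_def)
    qed
    ultimately have "\<theta>\<^sup>2 * (2 * p) ^ card S \<le> (c S)\<^sup>2 * (4 ^ d * (p * (1 - p)) ^ card S)"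
      using p by (intro mult_mono) auto
    then show "\<theta>\<^sup>2 * (2 * p) ^ card S \<le> 4 ^ d * ((c S)\<^sup>2 * (p * (1 - p)) ^ card S)" by (simp add: mult_ac)
  qed
  also have "\<dots> \<le> (\<Sum>S\<in>Pow A. 4 ^ d * ((c S)\<^sup>2 * (p * (1 - p)) ^ card S))"
    using fins p(5) by (intro sum_mono2) auto
  also have "\<dots> = 4 ^ d * expect p A (\<lambda>X. (?f X)\<^sup>2)"
    unfolding Parseval[OF assms(1) p(1,2)] c_def by (simp add: sum_distrib_left)
  also have "\<dots> \<le> 4 ^ d * expect p A (\<lambda>X. 1)"
    by (intro mult_left_mono expect_mono p) auto
  finally have M: "M \<le> 4 ^ d / \<theta>\<^sup>2"
    using assms(1,7) by (simp add: expect_const field_simps)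

  have HH: "S \<subseteq> A \<and> card S \<le> d \<and> \<bar>c S\<bar> \<le> 2 ^ d" if "S \<in> H" for S
    using that cH[OF that] by (auto simp: H_def)
  have "(\<Sum>R\<in>\<T>. p ^ card R) \<le> M / L"
    unfolding \<T>_def M_def by (rule core_approximation(1)[OF assms(1-3,9), where c = c]) (use HH in auto)
  also have "M / L \<le> 4 ^ d / (\<theta>\<^sup>2 * L)"
    using divide_right_mono[OF M, of L] assms(9) by simp
  finally have W: "(\<Sum>R\<in>\<T>. p ^ card R) \<le> 4 ^ d / (\<theta>\<^sup>2 * L)" .
  have "\<exists>G. expect p A (\<lambda>X. ((\<Sum>S\<in>H. c S * psi p S X) - G (core \<T> X))\<^sup>2) \<le> 16 ^ d * L * M"
    unfolding \<T>_def M_def by (rule core_approximation(2)[OF assms(1-3,9)]) (use HH in auto)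
  then obtain G where G: "expect p A (\<lambda>X. ((\<Sum>S\<in>H. c S * psi p S X) - G (core \<T> X))\<^sup>2) \<le> 16 ^ d * L * M"
    by blast
  have "16 ^ d * L * M \<le> 16 ^ d * L * (4 ^ d / \<theta>\<^sup>2)"
    using M assms(9) by (intro mult_left_mono) auto
  also have "\<dots> = 64 ^ d * L / \<theta>\<^sup>2"
  proof -
    have "(64::real) ^ d = 16 ^ d * 4 ^ d" by (simp add: power_mult_distrib[symmetric])
    then show ?thesis by simp
  qed
  finally have G': "expect p A (\<lambda>X. ((\<Sum>S\<in>H. c S * psi p S X) - G (core \<T> X))\<^sup>2) \<le> 64 ^ d * L / \<theta>\<^sup>2"
    using G by linarith

  have I: "(\<Sum>i\<in>A. 2 * p * influence p A F i) \<le> 2 * I"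
    unfolding I_def sum_distrib_left
  proof (intro sum_mono)
    fix i
    have "0 \<le> influence p A F i" unfolding influence_def by (intro expect_nonneg p) auto
    then have "0 \<le> (2 * p * (1 - 2 * p)) * influence p A F i" using assms(2,3) by (intro mult_nonneg_nonneg) auto
    then show "2 * p * influence p A F i \<le> 2 * (2 * p * (1 - p) * influence p A F i)"
      by (simp add: algebra_simps)
  qed
  \<comment> \<open>A set outside \<open>H\<close> and \<open>K\<close> has more than
    \<open>d\<close> elements, so \<open>d\<close> times its weight is at most its degree-weighted
    share.\<close>
  have tail: "(\<Sum>S\<in>Pow A - H - K. (c S)\<^sup>2 * (p * (1 - p)) ^ card S) \<le> I / (2 * d)"
  proof -
    have "d * (\<Sum>S\<in>Pow A - H - K. (c S)\<^sup>2 * (p * (1 - p)) ^ card S)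
        \<le> (\<Sum>S\<in>Pow A - H - K. card S * ((c S)\<^sup>2 * (p * (1 - p)) ^ card S))"
      unfolding sum_distrib_left
      by (intro sum_mono mult_right_mono[OF _ mult_nonneg_nonneg[OF zero_le_power2 zero_le_power[OF p(5)]]])
        (auto simp: H_def K_def)
    also have "\<dots> \<le> (\<Sum>S\<in>Pow A. card S * ((c S)\<^sup>2 * (p * (1 - p)) ^ card S))"
      using fins p(5) by (intro sum_mono2) auto
    also have "\<dots> = I / 2"
      unfolding c_def degree_weighted_Parseval[OF assms(1) p(1,2)] I_def
      by (simp add: sum_divide_distrib mult.assoc)
    finally show ?thesis using assms(10) by (simp add: field_simps)
  qed
  have small: "(\<Sum>S\<in>K. (c S)\<^sup>2 * (p * (1 - p)) ^ card S)
      \<le> 2 * \<theta> * 2 ^ d * (d / t ^ 3 + 1) ^ d + 12 ^ d * t * (2 * I)"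
  proof -
    have "(\<Sum>S\<in>K. (c S)\<^sup>2 * (p * (1 - p)) ^ card S) \<le> (\<Sum>S\<in>K. (2 * p) ^ card S * (c S)\<^sup>2)"
      by (intro sum_mono) (use p2 in \<open>simp add: mult.commute[of "(c _)\<^sup>2"] mult_right_mono\<close>)
    also have "\<dots> \<le> 2 * \<theta> * 2 ^ d * (d / t ^ 3 + 1) ^ d + 12 ^ d * t * (\<Sum>i\<in>A. 2 * p * influence p A F i)"
      unfolding K_def c_def by (rule small_coef_mass) (use assms in auto)
    also have "12 ^ d * t * (\<Sum>i\<in>A. 2 * p * influence p A F i) \<le> 12 ^ d * t * (2 * I)"
      using I assms(8) by (intro mult_left_mono) auto
    finally show ?thesis by simp
  qed
  have "expect p A (\<lambda>X. (?f X - (\<Sum>S\<in>H. c S * psi p S X))\<^sup>2) = (\<Sum>S\<in>Pow A - H. (c S)\<^sup>2 * (p * (1 - p)) ^ card S)"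
    unfolding c_def by (rule expansion_truncation[OF assms(1) p(1,2) fins(2)])
  also have "\<dots> = (\<Sum>S\<in>Pow A - H - K. (c S)\<^sup>2 * (p * (1 - p)) ^ card S) + (\<Sum>S\<in>K. (c S)\<^sup>2 * (p * (1 - p)) ^ card S)"
    by (rule sum.subset_diff) (use fins in \<open>auto simp: H_def K_def\<close>)
  finally have fH: "expect p A (\<lambda>X. (?f X - (\<Sum>S\<in>H. c S * psi p S X))\<^sup>2)
      \<le> 2 * \<theta> * 2 ^ d * (d / t ^ 3 + 1) ^ d + 12 ^ d * t * (2 * I) + I / (2 * d)"
    using small tail by linarith
  have "expect p A (\<lambda>X. (?f X - G (core \<T> X))\<^sup>2)
    \<le> expect p A (\<lambda>X. 2 * (?f X - (\<Sum>S\<in>H. c S * psi p S X))\<^sup>2 + 2 * ((\<Sum>S\<in>H. c S * psi p S X) - G (core \<T> X))\<^sup>2)"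
  proof (intro expect_mono p)
    fix X
    have "(a - b)\<^sup>2 \<le> 2 * (a - s)\<^sup>2 + 2 * (s - b)\<^sup>2" for a b s :: real
      using zero_le_power2[of "a + b - 2 * s"] by (simp add: power2_eq_square algebra_simps)
    then show "(?f X - G (core \<T> X))\<^sup>2 \<le> 2 * (?f X - (\<Sum>S\<in>H. c S * psi p S X))\<^sup>2
        + 2 * ((\<Sum>S\<in>H. c S * psi p S X) - G (core \<T> X))\<^sup>2" .
  qed
  also have "\<dots> \<le> 2 * (2 * \<theta> * 2 ^ d * (d / t ^ 3 + 1) ^ d + 12 ^ d * t * (2 * I) + I / (2 * d)) + 2 * (64 ^ d * L / \<theta>\<^sup>2)"
    unfolding expect_add expect_cmult by (intro add_mono mult_left_mono fH G') auto
  finally have fG: "expect p A (\<lambda>X. (?f X - G (core \<T> X))\<^sup>2)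
    \<le> 2 * (2 * \<theta> * 2 ^ d * (d / t ^ 3 + 1) ^ d + 12 ^ d * t * (2 * I) + I / (2 * d)) + 2 * (64 ^ d * L / \<theta>\<^sup>2)" .
  show ?thesis
    by (rule no_booster_le_core[where F = F, OF assms(1) p(1,2) assms(4-6) F _ W fG]) (auto simp: \<T>_def)
qed

text \<open>Vanishing influence kills the weight of all nonempty sets, so a constant approximates
  \<open>F\<close> without error and the empty family serves as \<open>\<T>\<close>. The case is
  separate because a degree bound proportional to \<open>\<lceil>I\<rceil>\<close> would be
  0.\<close>

lemma no_booster_zero_influence:
  fixes F :: "'a set \<Rightarrow> bool"
  assumes "finite A" "0 < p" "p \<le> 1 / 2" "0 < \<delta>" "\<delta> < 1" "0 < k"
    and F: "\<And>X Y. X \<subseteq> Y \<Longrightarrow> Y \<subseteq> A \<Longrightarrow> F X \<Longrightarrow> F Y"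
    and I: "(\<Sum>i\<in>A. 2 * p * (1 - p) * influence p A F i) = 0"
  shows "expect p A (\<lambda>X. of_bool (F X \<and> no_booster p A F \<delta> k X)) \<le> 0"
proof -
  have p: "0 < p" "p < 1" "0 \<le> p * (1 - p)" using assms(2,3) by auto
  let ?f = "\<lambda>X. of_bool (F X) :: real"
  let ?c = "coef p A ?f"
  have "expect p A (\<lambda>X. (?f X - (\<Sum>S\<in>{{}}. ?c S * psi p S X))\<^sup>2)
      = (\<Sum>S\<in>Pow A - {{}}. (?c S)\<^sup>2 * (p * (1 - p)) ^ card S)"
    by (rule expansion_truncation[OF assms(1) p(1,2)]) auto
  also have "\<dots> \<le> (\<Sum>S\<in>Pow A - {{}}. card S * ((?c S)\<^sup>2 * (p * (1 - p)) ^ card S))"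
  proof (intro sum_mono)
    fix S assume S: "S \<in> Pow A - {{}}"
    then have "finite S" using assms(1) finite_subset by auto
    then have "1 \<le> real (card S)" using S by (simp add: Suc_le_eq card_gt_0_iff)
    then have "1 * ((?c S)\<^sup>2 * (p * (1 - p)) ^ card S) \<le> card S * ((?c S)\<^sup>2 * (p * (1 - p)) ^ card S)"
      by (rule mult_right_mono[OF _ mult_nonneg_nonneg[OF zero_le_power2 zero_le_power[OF p(3)]]])
    then show "(?c S)\<^sup>2 * (p * (1 - p)) ^ card S \<le> card S * ((?c S)\<^sup>2 * (p * (1 - p)) ^ card S)" by simp
  qed
  also have "\<dots> \<le> (\<Sum>S\<in>Pow A. card S * ((?c S)\<^sup>2 * (p * (1 - p)) ^ card S))"
    using assms(1) p(3) by (intro sum_mono2) auto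
  also have "\<dots> = (\<Sum>i\<in>A. 2 * p * (1 - p) * influence p A F i) / 2"
    unfolding degree_weighted_Parseval[OF assms(1) p(1,2)] by (simp add: sum_divide_distrib mult.assoc)
  \<comment> \<open>A constant is a function of the core of the empty family.\<close>
  finally have *: "expect p A (\<lambda>X. (?f X - (\<lambda>_. ?c {}) (core {} X))\<^sup>2) \<le> 0"
    using I by (simp add: psi_def)
  show ?thesis
    using no_booster_le_core[where F = F and W = 0 and d = 0 and \<T> = "{}", OF assms(1) p(1,2) assms(4-6) _ _ _ *] F
    by simp
qed

text \<open>The parameters are fixed in turn: \<open>d\<close> for the degree tail, \<open>t\<close>
  for the influence term, \<open>\<theta>\<close> for the count of sets, \<open>L\<close> for the
  core approximation. The size of the core is then exponential in \<open>d\<^sup>2\<close>, which is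
  where the squares in \<open>k\<close> come from.\<close>

lemma no_booster_bound:
  fixes F :: "'a set \<Rightarrow> bool" and \<epsilon> \<delta> p :: real
  assumes "finite A" "0 < p" "p \<le> 1 / 2" "0 < \<delta>" "\<delta> < 1" "0 < \<epsilon>" "\<epsilon> < 1"
    and F: "\<And>X Y. X \<subseteq> Y \<Longrightarrow> Y \<subseteq> A \<Longrightarrow> F X \<Longrightarrow> F Y"
  defines "I \<equiv> \<Sum>i\<in>A. 2 * p * (1 - p) * influence p A F i"
  defines "k \<equiv> exp (10 ^ 12 * (real_of_int \<lceil>I\<rceil>)\<^sup>2 * (\<delta> * \<epsilon>) powi (-2))"
  shows "expect p A (\<lambda>X. of_bool (F X \<and> no_booster p A F \<delta> k X)) \<le> \<epsilon>"
proof -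
  have I0: "0 \<le> I"
    unfolding I_def influence_def using assms(2,3)
    by (intro sum_nonneg mult_nonneg_nonneg expect_nonneg) auto
  have k0: "0 < k" unfolding k_def by simp
  show ?thesis
  proof (cases "I = 0")
    case True
    have "expect p A (\<lambda>X. of_bool (F X \<and> no_booster p A F \<delta> k X)) \<le> 0"
      by (rule no_booster_zero_influence[where F = F, OF assms(1-5) k0 F]) (use True in \<open>simp_all add: I_def\<close>)
    then show ?thesis using assms(6) by linarith
  next
    case False
    define C where "C = real_of_int \<lceil>I\<rceil>"
    define \<eta> where "\<eta> = \<delta> * \<epsilon>"
    \<comment> \<open>This choice makes the degree tail \<open>I / (2 * d)\<close> at most
      \<open>\<eta> / 16\<close>.\<close>
    define d where "d = nat \<lceil>8 * C / \<eta>\<rceil>"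
    have "0 < \<lceil>I\<rceil>" using False I0 by simp
    then have C: "1 \<le> C" "I \<le> C" unfolding C_def by linarith+
    have \<eta>: "0 < \<eta>" "\<eta> < 1" "\<eta> \<le> \<epsilon>"
      unfolding \<eta>_def using assms(4-7) by (auto simp: mult_less_cancel_right2 intro: mult_strict_mono[of \<delta> 1 \<epsilon> 1, simplified] mult_left_le_one_le)
    have C\<eta>: "1 \<le> C / \<eta>" using C \<eta> by (simp add: field_simps)
    have d_lower: "8 * C / \<eta> \<le> d" unfolding d_def using C\<eta> by linarith
    have d_upper: "d \<le> 9 * (C / \<eta>)" unfolding d_def using C\<eta> by linarith
    have d8: "8 \<le> d" using d_lower C\<eta> by linarith
    have d_pow: "real d + 1 \<le> 2 ^ d"
    proof -
      have "d + 1 \<le> 2 ^ d" using less_exp[of d] by (simp add: Suc_le_eq)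
      then have "real (d + 1) \<le> real (2 ^ d)" by (rule of_nat_mono)
      then show ?thesis by simp
    qed
    have dC: "8 * C \<le> d * \<eta>" using d_lower \<eta> by (simp add: field_simps)
    have \<eta>_lower: "8 / 2 ^ d \<le> \<eta>"
    proof -
      have "8 \<le> d * \<eta>" using dC C by linarith
      also have "\<dots> \<le> 2 ^ d * \<eta>" using d_pow \<eta> by (intro mult_right_mono) auto
      finally show ?thesis by (simp add: field_simps)
    qed
    \<comment> \<open>Each of the other approximation errors is reduced to this power of 2.\<close>
    have tiny: "1 / 2 ^ (2 * d) \<le> \<eta> / 32"
    proof -
      have "1 / 2 ^ (2 * d) = 1 / 2 ^ d * (1 / 2 ^ d :: real)" by (simp add: mult_2 power_add)
      also have "\<dots> \<le> 1 / 4 * (\<eta> / 8)"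
      proof (intro mult_mono)
        have "(2::real) ^ 2 \<le> 2 ^ d" using d8 by (intro power_increasing) auto
        then show "1 / 2 ^ d \<le> (1 / 4 :: real)" by (simp add: field_simps)
        show "1 / 2 ^ d \<le> \<eta> / 8" using \<eta>_lower by simp
      qed auto
      finally show ?thesis by simp
    qed
    have quot: "2 ^ a / 2 ^ (a + b) = (1 / 2 ^ b :: real)" for a b by (simp add: power_add)
    \<comment> \<open>Of the seven multiples of \<open>d\<close>, four pay for \<open>12 ^ d\<close>
      and one for \<open>2 * I\<close>; two remain for \<open>tiny\<close>.\<close>
    define t :: real where "t = 1 / 2 ^ (7 * d)"
    \<comment> \<open>\<open>(d / t ^ 3 + 1) ^ d\<close> costs at most
      \<open>2 ^ (22 * d * d)\<close>: 21 from \<open>t ^ 3\<close> and 1 from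
      \<open>d + 1 \<le> 2 ^ d\<close>. The other \<open>4 * d * d\<close> covers the linear terms
      and leaves \<open>2 * d\<close>.\<close>
    define \<theta> :: real where "\<theta> = 1 / 2 ^ (26 * d * d)"
    \<comment> \<open>Here \<open>64 ^ d\<close> uses \<open>6 * d\<close> of the exponent
      \<open>8 * d\<close>.\<close>
    define L where "L = \<theta>\<^sup>2 / 2 ^ (8 * d)"
    have pos: "0 < t" "0 < \<theta>" "0 < L" unfolding t_def \<theta>_def L_def by auto
    have b1: "2 * \<theta> * 2 ^ d * (d / t ^ 3 + 1) ^ d \<le> \<eta> / 32"
    proof -
      have "d / t ^ 3 + 1 \<le> (real d + 1) * 2 ^ (21 * d)"
        unfolding t_def by (simp add: power_divide power_mult[symmetric] algebra_simps)
      also have "\<dots> \<le> 2 ^ d * 2 ^ (21 * d)" using d_pow by (intro mult_right_mono) auto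
      also have "\<dots> = 2 ^ (22 * d)" by (simp add: power_add[symmetric])
      finally have "(d / t ^ 3 + 1) ^ d \<le> (2 ^ (22 * d)) ^ d"
        using pos by (intro power_mono) auto
      then have "2 * \<theta> * 2 ^ d * (d / t ^ 3 + 1) ^ d \<le> 2 * \<theta> * 2 ^ d * 2 ^ (22 * d * d)"
        using pos by (intro mult_left_mono) (auto simp: power_mult[symmetric])
      also have "\<dots> = 2 ^ (1 + d + 22 * d * d) / 2 ^ (26 * d * d)"
        unfolding \<theta>_def by (simp add: power_add)
      also have "\<dots> \<le> 1 / 2 ^ (2 * d)"
      proof -
        have "8 * d \<le> d * d" using d8 by simp
        then have "1 + d + 22 * d * d + 2 * d \<le> 26 * d * d" using d8 unfolding mult.assoc by linarith
        then have "(2::real) ^ (1 + d + 22 * d * d) * 2 ^ (2 * d) \<le> 2 ^ (26 * d * d)"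
          unfolding power_add[symmetric] by (intro power_increasing) auto
        moreover have "x / z \<le> 1 / y" if "x * y \<le> z" "0 < y" "0 < z" for x y z :: real
          using that by (simp add: field_simps)
        ultimately show ?thesis by (meson zero_less_numeral zero_less_power)
      qed
      finally show ?thesis using tiny by linarith
    qed
    have b2: "12 ^ d * t * (2 * I) \<le> \<eta> / 32"
    proof -
      have "2 * I \<le> 2 ^ d"
      proof -
        have "d * \<eta> \<le> d" using \<eta> by (simp add: mult_left_le)
        then show ?thesis using dC C d_pow by linarith
      qed
      moreover have "(12::real) ^ d \<le> 2 ^ (4 * d)"
        unfolding power_mult by (intro power_mono) auto
      ultimately have "12 ^ d * t * (2 * I) \<le> 2 ^ (4 * d) * t * 2 ^ d"
        using pos I0 by (intro mult_mono) auto
      also have "\<dots> = 2 ^ (5 * d) / 2 ^ (7 * d)" unfolding t_def by (simp add: power_add[symmetric])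
      also have "\<dots> = 1 / 2 ^ (2 * d)"
        using quot[of "5 * d" "2 * d"] by simp
      finally show ?thesis using tiny by linarith
    qed
    have b3: "I / (2 * d) \<le> \<eta> / 16"
      using dC C d8 by (simp add: field_simps)
    have b4: "64 ^ d * L / \<theta>\<^sup>2 \<le> \<eta> / 32"
    proof -
      have "64 ^ d * L / \<theta>\<^sup>2 = 2 ^ (6 * d) / 2 ^ (8 * d)"
        unfolding L_def using pos by (simp add: power_mult)
      also have "\<dots> = 1 / 2 ^ (2 * d)" using quot[of "6 * d" "2 * d"] by simp
      finally show ?thesis using tiny by linarith
    qed
    have b5: "d * (4 ^ d / (\<theta>\<^sup>2 * L)) / k \<le> \<epsilon> / 2"
    proof -
      have "d * (4 ^ d / (\<theta>\<^sup>2 * L)) = real d * 2 ^ (2 * d + 8 * d + 104 * d * d)"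
      proof -
        have \<theta>2: "\<theta>\<^sup>2 = 1 / 2 ^ (52 * d * d)"
          unfolding \<theta>_def by (simp add: power_divide flip: power_mult)
        have "\<theta>\<^sup>2 * L = 1 / (2 ^ (52 * d * d) * 2 ^ (52 * d * d) * 2 ^ (8 * d))"
          unfolding L_def \<theta>2 by simp
        also have "\<dots> = 1 / 2 ^ (8 * d + 104 * d * d)"
          by (simp add: algebra_simps flip: power_add)
        finally have "4 ^ d / (\<theta>\<^sup>2 * L) = 2 ^ (2 * d) * 2 ^ (8 * d + 104 * d * d)"
          by (simp add: power_mult)
        then show ?thesis by (simp only: power_add[symmetric] add.assoc)
      qed
      also have "\<dots> \<le> 2 ^ d * 2 ^ (2 * d + 8 * d + 104 * d * d)"
        using d_pow by (intro mult_right_mono) auto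
      \<comment> \<open>One factor \<open>2 ^ d\<close> has been spent on \<open>d\<close>; a second
        is split off to pay for \<open>\<epsilon> / 2\<close>.\<close>
      also have "\<dots> = 2 ^ (12 * d + 104 * d * d) / 2 ^ d"
      proof -
        have "(2::real) ^ (12 * d + 104 * d * d) = 2 ^ d * 2 ^ (2 * d + 8 * d + 104 * d * d) * 2 ^ d"
          unfolding power_add[symmetric] by (rule arg_cong) simp
        then show ?thesis by simp
      qed
      also have "\<dots> \<le> k * (1 / 2 ^ d)"
      proof -
        have "(2::real) ^ (12 * d + 104 * d * d) \<le> exp 1 ^ (12 * d + 104 * d * d)"
          using exp_ge_add_one_self[of 1] by (intro power_mono) auto
        also have "\<dots> = exp (real (12 * d + 104 * d * d))" by (metis exp_of_nat_mult mult.right_neutral)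
        also have "\<dots> \<le> k"
          unfolding k_def
        proof (subst exp_le_cancel_iff)
          have "d \<le> d * d" by simp
          then have "12 * d + 104 * d * d \<le> 116 * (d * d)" unfolding mult.assoc by linarith
          then have "real (12 * d + 104 * d * d) \<le> real (116 * (d * d))" by (rule of_nat_mono)
          then have "real (12 * d + 104 * d * d) \<le> 116 * (real d)\<^sup>2" by (simp add: power2_eq_square)
          also have "\<dots> \<le> 116 * (9 * (C / \<eta>))\<^sup>2"
            using d_upper by (intro mult_left_mono power_mono) auto
          \<comment> \<open>The constant on the left is \<open>116 * 81 = 9396\<close>.\<close>
          also have "\<dots> \<le> 10 ^ 12 * (C / \<eta>)\<^sup>2" unfolding power_mult_distrib by simp
          also have "\<dots> = 10 ^ 12 * (real_of_int \<lceil>I\<rceil>)\<^sup>2 * (\<delta> * \<epsilon>) powi (-2)"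
            by (simp add: C_def \<eta>_def power_int_minus power_mult_distrib power_inverse divide_inverse)
          finally show "real (12 * d + 104 * d * d) \<le> 10 ^ 12 * (real_of_int \<lceil>I\<rceil>)\<^sup>2 * (\<delta> * \<epsilon>) powi (-2)" .
        qed
        finally show ?thesis by (simp add: divide_right_mono)
      qed
      also have "\<dots> \<le> k * (\<epsilon> / 2)"
        using \<eta>_lower \<eta> k0 by (intro mult_left_mono) auto
      also have "k * (\<epsilon> / 2) = \<epsilon> / 2 * k" by (rule mult.commute)
      finally show ?thesis unfolding pos_divide_le_eq[OF k0] .
    qed
    have "expect p A (\<lambda>X. of_bool (F X \<and> no_booster p A F \<delta> k X))
      \<le> (2 * (2 * \<theta> * 2 ^ d * (d / t ^ 3 + 1) ^ d + 12 ^ d * t * (2 * I) + I / (2 * d)) + 2 * (64 ^ d * L / \<theta>\<^sup>2)) / \<delta>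
      + d * (4 ^ d / (\<theta>\<^sup>2 * L)) / k"
      unfolding I_def by (rule no_booster_parametric[where F = F, OF assms(1-5) k0 pos(2,1,3) _ F]) (use d8 in auto)
    \<comment> \<open>The approximation errors add up to \<open>10 / 32 * \<eta>\<close>, below
      \<open>\<eta> / 2\<close>, and division by \<open>\<delta>\<close> leaves at most
      \<open>\<epsilon> / 2\<close>; the other half goes to the size of the core.\<close>
    also have "\<dots> \<le> (2 * (\<eta> / 32 + \<eta> / 32 + \<eta> / 16) + 2 * (\<eta> / 32)) / \<delta> + \<epsilon> / 2"
      by (intro add_mono b1 b2 b3 b4 b5 divide_right_mono mult_left_mono) (use assms(4) in auto)
    also have "\<dots> \<le> (\<eta> / 2) / \<delta> + \<epsilon> / 2"
      using \<eta> assms(4) by (intro add_right_mono divide_right_mono) auto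
    also have "\<dots> = \<epsilon>" unfolding \<eta>_def using assms(4) by simp
    finally show ?thesis .
  qed
qed

subsection \<open>Transfer to the measure of the cube\<close>

lemma cube_eq_image: "cube n = (\<lambda>X i. i \<in> X) ` Pow {1..n}"
proof
  show "cube n \<subseteq> (\<lambda>X i. i \<in> X) ` Pow {1..n}"
  proof
    fix x assume "x \<in> cube n"
    then have "{i. x i} \<in> Pow {1..n}" by (auto simp: cube_def PiE_dflt_def)
    moreover have "x = (\<lambda>i. i \<in> {i. x i})" by simp
    ultimately show "x \<in> (\<lambda>X i. i \<in> X) ` Pow {1..n}" by blast
  qed
qed (auto simp: cube_def PiE_dflt_def)

lemma sum_mu_eq_ex:
  assumes "0 \<le> p" "p \<le> 1"
  shows "(\<Sum>x\<in>cube n. pmf (mu n p) x * g x) = expect p {1..n} (\<lambda>X. g (\<lambda>i. i \<in> X))"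
proof -
  have inj: "inj_on (\<lambda>X i. i \<in> X) (Pow {1..n})"
    by (auto simp: inj_on_def fun_eq_iff)
  have "(\<Sum>x\<in>cube n. pmf (mu n p) x * g x) = (\<Sum>X\<in>Pow {1..n}. pmf (mu n p) (\<lambda>i. i \<in> X) * g (\<lambda>i. i \<in> X))"
    unfolding cube_eq_image by (subst sum.reindex[OF inj]) simp
  also have "\<dots> = expect p {1..n} (\<lambda>X. g (\<lambda>i. i \<in> X))"
    unfolding expect_def
  proof (rule sum.cong[OF refl])
    fix X assume X: "X \<in> Pow {1..n}"
    have s: "(\<Sum>i\<in>{1..n}. of_bool (i \<in> X)) = card X"
      using X by (simp add: of_bool_def sum.If_cases Int_absorb1)
    have "card ({1..n} - X) = n - card X"
      using X by (simp add: card_Diff_subset finite_subset[of X "{1..n}"])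
    moreover have "(\<lambda>i. i \<in> X) \<in> cube n" unfolding cube_eq_image using X by blast
    ultimately show "pmf (mu n p) (\<lambda>i. i \<in> X) * g (\<lambda>i. i \<in> X)
        = p ^ card X * (1 - p) ^ card ({1..n} - X) * g (\<lambda>i. i \<in> X)"
      using pmf_mu[of "\<lambda>i. i \<in> X" n p] assms s by simp
  qed
  finally show ?thesis .
qed

lemma finite_cube: "finite (cube n)"
  unfolding cube_eq_image by simp

lemma prob_mu:
  assumes "0 \<le> p" "p \<le> 1"
  shows "measure_pmf.prob (mu n p) B = expect p {1..n} (\<lambda>X. of_bool ((\<lambda>i. i \<in> X) \<in> B))"
proof -
  have "measure_pmf.prob (mu n p) B = measure_pmf.prob (mu n p) (B \<inter> cube n)"
    by (rule measure_prob_cong_0) (use set_mu_subset_cube[of n p] in \<open>auto simp: set_pmf_iff\<close>)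
  also have "\<dots> = (\<Sum>x\<in>B \<inter> cube n. pmf (mu n p) x)"
    by (rule measure_measure_pmf_finite) (simp add: finite_cube)
  also have "\<dots> = (\<Sum>x\<in>cube n. pmf (mu n p) x * of_bool (x \<in> B))"
    by (rule sum.mono_neutral_cong_left) (auto simp: finite_cube)
  finally show ?thesis unfolding sum_mu_eq_ex[OF assms] .
qed

text \<open>The condition has probability \<open>p ^ card S > 0\<close>, so \<open>cond_pmf\<close>
  is the genuine conditional distribution, and this probability cancels the factor from
  \<open>expect_superset\<close>.\<close>

lemma expectation_cond_mu:
  assumes "0 < p" "p \<le> 1" "S \<subseteq> {1..n}"
  shows "measure_pmf.expectation (cond_pmf (mu n p) {x. \<forall>i\<in>S. x i}) (\<lambda>x. of_bool (f x))
    = expect p ({1..n} - S) (\<lambda>Y. of_bool (f (\<lambda>i. i \<in> S \<union> Y)))"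
proof -
  let ?B = "{x. \<forall>i\<in>S. x i}"
  have B: "measure_pmf.prob (mu n p) ?B = p ^ card S"
    unfolding prob_mu[OF less_imp_le[OF assms(1)] assms(2)]
    using expect_contains[OF _ assms(3), of p] by (simp add: subset_eq)
  have ne: "set_pmf (mu n p) \<inter> ?B \<noteq> {}"
  proof
    assume "set_pmf (mu n p) \<inter> ?B = {}"
    then have "measure_pmf.prob (mu n p) ?B = 0" by (simp add: measure_pmf_zero_iff)
    then show False using B assms(1) by simp
  qed
  have "measure_pmf.expectation (cond_pmf (mu n p) ?B) (\<lambda>x. of_bool (f x))
    = (\<Sum>x\<in>cube n. of_bool (f x) * pmf (cond_pmf (mu n p) ?B) x)"
    by (rule integral_measure_pmf_real)
       (use set_mu_subset_cube[of n p] in \<open>auto simp: finite_cube set_cond_pmf[OF ne]\<close>)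
  also have "\<dots> = (\<Sum>x\<in>cube n. pmf (mu n p) x * (of_bool (\<forall>i\<in>S. x i) * of_bool (f x) / p ^ card S))"
    by (rule sum.cong) (auto simp: pmf_cond[OF ne] B)
  also have "\<dots> = expect p {1..n} (\<lambda>X. of_bool (S \<subseteq> X) * of_bool (f (\<lambda>i. i \<in> X))) / p ^ card S"
    unfolding sum_mu_eq_ex[OF less_imp_le[OF assms(1)] assms(2)]
    using expect_multc[of p "{1..n}" "\<lambda>X. of_bool (S \<subseteq> X) * of_bool (f (\<lambda>i. i \<in> X))" "1 / p ^ card S"]
    by (simp add: subset_eq)
  also have "\<dots> = expect p ({1..n} - S) (\<lambda>Y. of_bool (f (\<lambda>i. i \<in> S \<union> Y)))"
    unfolding expect_superset[OF finite_atLeastAtMost assms(3)] using assms(1) by simp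
  finally show ?thesis .
qed

text \<open>Resampling changes \<open>f\<close> exactly if \<open>i\<close> is pivotal and the copy
  differs from the original. These events are independent, and the second has probability
  \<open>2 * p * (1 - p)\<close>.\<close>

lemma total_influence_eq:
  assumes "0 \<le> p" "p \<le> 1"
  shows "total_influence n f p = (\<Sum>i\<in>{1..n}. 2 * p * (1 - p) * influence p {1..n} (\<lambda>X. f (\<lambda>j. j \<in> X)) i)"
  unfolding total_influence_def
proof (rule sum.cong[OF refl])
  fix i assume i: "i \<in> {1..n}"
  let ?A = "{1..n}" and ?F = "\<lambda>X. f (\<lambda>j. j \<in> X)"
  let ?E = "{(x, b). f x \<noteq> f (x(i := b))}" and ?M = "pair_pmf (mu n p) (bernoulli_pmf p)"
  have fin: "finite (cube n \<times> (UNIV :: bool set))" by (simp add: finite_cube)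
  have "measure_pmf.prob ?M ?E = measure_pmf.prob ?M (?E \<inter> cube n \<times> UNIV)"
    by (rule measure_prob_cong_0) (use set_mu_subset_cube[of n p] in \<open>auto simp: pmf_pair set_pmf_iff\<close>)
  also have "\<dots> = (\<Sum>z\<in>?E \<inter> cube n \<times> UNIV. pmf ?M z)"
    by (rule measure_measure_pmf_finite) (use fin in auto)
  also have "\<dots> = (\<Sum>z\<in>cube n \<times> UNIV. pmf ?M z * of_bool (z \<in> ?E))"
    by (rule sum.mono_neutral_cong_left) (use fin in auto)
  also have "\<dots> = (\<Sum>x\<in>cube n. \<Sum>b\<in>UNIV. pmf ?M (x, b) * of_bool ((x, b) \<in> ?E))"
    unfolding sum.cartesian_product by (rule sum.cong) auto
  also have "\<dots> = (\<Sum>x\<in>cube n. pmf (mu n p) x *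
      (p * of_bool (f x \<noteq> f (x(i := True))) + (1 - p) * of_bool (f x \<noteq> f (x(i := False)))))"
    using assms by (intro sum.cong refl) (simp add: UNIV_bool pmf_pair algebra_simps)
  also have "\<dots> = expect p ?A (\<lambda>X. p * of_bool (?F X \<noteq> ?F (insert i X)) + (1 - p) * of_bool (?F X \<noteq> ?F (X - {i})))"
  proof -
    have "(\<lambda>j. j \<in> X)(i := True) = (\<lambda>j. j \<in> insert i X)" "(\<lambda>j. j \<in> X)(i := False) = (\<lambda>j. j \<in> X - {i})"
      for X :: "nat set" by (auto simp: fun_eq_iff)
    then show ?thesis unfolding sum_mu_eq_ex[OF assms] by simp
  qed
  also have "\<dots> = 2 * p * (1 - p) * expect p (?A - {i}) (\<lambda>X. of_bool (?F (insert i X) \<noteq> ?F X))"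
  proof -
    let ?D = "\<lambda>X. of_bool (?F (insert i X) \<noteq> ?F X) :: real"
    have d: "insert i X - {i} = X" "X - {i} = X" if "X \<subseteq> ?A - {i}" for X
      using that by auto
    \<comment> \<open>With the original equal to 1, only a copy equal to 0 can change
      \<open>f\<close>; the next fact is the opposite case.\<close>
    have a: "expect p (?A - {i}) (\<lambda>X. p * of_bool (?F (insert i X) \<noteq> ?F (insert i (insert i X)))
        + (1 - p) * of_bool (?F (insert i X) \<noteq> ?F (insert i X - {i}))) = expect p (?A - {i}) (\<lambda>X. (1 - p) * ?D X)"
      by (rule expect_cong) (simp add: d)
    have b: "expect p (?A - {i}) (\<lambda>X. p * of_bool (?F X \<noteq> ?F (insert i X))
        + (1 - p) * of_bool (?F X \<noteq> ?F (X - {i}))) = expect p (?A - {i}) (\<lambda>X. p * ?D X)"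
      by (rule expect_cong) (auto simp: d)
    show ?thesis
      unfolding expect_remove[OF finite_atLeastAtMost i] a b expect_cmult by (simp add: algebra_simps)
  qed
  also have "expect p (?A - {i}) (\<lambda>X. of_bool (?F (insert i X) \<noteq> ?F X)) = influence p ?A ?F i"
  proof -
    let ?D = "\<lambda>X. of_bool (?F (insert i X) \<noteq> ?F X) :: real"
    have d: "insert i X - {i} = X" "X - {i} = X" if "X \<subseteq> ?A - {i}" for X
      using that by auto
    have a: "expect p (?A - {i}) (\<lambda>X. of_bool (?F (insert i (insert i X)) \<noteq> ?F (insert i X - {i}))) = expect p (?A - {i}) ?D"
      "expect p (?A - {i}) (\<lambda>X. of_bool (?F (insert i X) \<noteq> ?F (X - {i}))) = expect p (?A - {i}) ?D"
      by (rule expect_cong; simp add: d)+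
    show ?thesis
      unfolding influence_def expect_remove[OF finite_atLeastAtMost i] a by (simp add: algebra_simps)
  qed
  finally show "measure_pmf.prob ?M ?E = 2 * p * (1 - p) * influence p ?A ?F i" .
qed

theorem proposition1p4:
  fixes n :: nat and f :: "(nat \<Rightarrow> bool) \<Rightarrow> bool" and p \<epsilon> \<delta> k :: real
  assumes "n \<ge> 1"
    and "increasing_on_cube n f"
    and "0 < p" and "p \<le> 1 / 2"
    and "\<epsilon> > 0" and "\<delta> > 0"
    and "k = exp (10 ^ 12 * (real_of_int \<lceil>total_influence n f p\<rceil>)\<^sup>2 * (\<delta> * \<epsilon>) powi (-2))"
  shows "measure_pmf.prob (mu n p) ({x \<in> cube n. f x} - boosting_event n f p \<delta> k) \<le> \<epsilon>"
proof -
  let ?A = "{1..n}"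
  define F where "F X = f (\<lambda>i. i \<in> X)" for X
  have p: "0 \<le> p" "p \<le> 1" using assms(3,4) by auto
  have boosting: "boosting_set n f p \<delta> S \<longleftrightarrow> 1 - \<delta> \<le> expect p (?A - S) (\<lambda>Y. of_bool (F (S \<union> Y)))"
    if "S \<subseteq> ?A" for S
    unfolding boosting_set_def expectation_cond_mu[OF assms(3) p(2) that] F_def using that by simp
  have mono: "F Y" if "X \<subseteq> Y" "Y \<subseteq> ?A" "F X" for X Y
  proof -
    have "(\<lambda>i. i \<in> X) \<in> cube n" "(\<lambda>i. i \<in> Y) \<in> cube n"
      unfolding cube_eq_image using that by blast+
    moreover have "\<forall>i\<in>?A. (i \<in> Y) \<ge> (i \<in> X)" using that by auto
    ultimately have "f (\<lambda>i. i \<in> Y) \<ge> f (\<lambda>i. i \<in> X)"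
      by (intro assms(2)[unfolded increasing_on_cube_def, rule_format]) auto
    then show ?thesis using that unfolding F_def by simp
  qed
  have *: "measure_pmf.prob (mu n p) ({x \<in> cube n. f x} - boosting_event n f p \<delta> k)
      = expect p ?A (\<lambda>X. of_bool (F X \<and> no_booster p ?A F \<delta> k X))"
    unfolding prob_mu[OF p]
  proof (rule expect_cong)
    fix X assume X: "X \<subseteq> ?A"
    then have 1: "(\<lambda>i. i \<in> X) \<in> cube n" unfolding cube_eq_image by blast
    have 2: "{i \<in> ?A. i \<in> X} = X" using X by auto
    have "(\<lambda>i. i \<in> X) \<in> boosting_event n f p \<delta> k \<longleftrightarrow> \<not> no_booster p ?A F \<delta> k X"
      unfolding boosting_event_def no_booster_def mem_Collect_eq 2
      using 1 X boosting by (auto simp: not_less)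
    then show "of_bool ((\<lambda>i. i \<in> X) \<in> {x \<in> cube n. f x} - boosting_event n f p \<delta> k)
        = (of_bool (F X \<and> no_booster p ?A F \<delta> k X) :: real)"
      using 1 by (simp add: F_def)
  qed
  \<comment> \<open>For \<open>1 \<le> \<epsilon>\<close> the bound is trivial; for
    \<open>1 \<le> \<delta>\<close> the empty set boosts, as \<open>1 - \<delta> \<le> 0\<close>.
    The remaining case has both below 1, as \<open>no_booster_bound\<close> requires.\<close>
  consider "1 \<le> \<epsilon>" | "1 \<le> \<delta>" | "\<epsilon> < 1" "\<delta> < 1" by linarith
  then show ?thesis
  proof cases
    case 1
    then show ?thesis using measure_pmf.prob_le_1 order.trans by blast
  next
    case 2
    have "\<not> no_booster p ?A F \<delta> k X" for X
    proof -
      have "0 \<le> k" using assms(7) by simp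
      moreover have "1 - \<delta> \<le> expect p (?A - {}) (\<lambda>Y. of_bool (F ({} \<union> Y)))"
        using 2 expect_nonneg[OF p, of "?A - {}" "\<lambda>Y. of_bool (F ({} \<union> Y))"] by simp
      ultimately show ?thesis unfolding no_booster_def by (auto simp: not_less)
    qed
    then show ?thesis using assms(5) unfolding * by (simp add: expect_const)
  next
    case 3
    have "total_influence n f p = (\<Sum>i\<in>?A. 2 * p * (1 - p) * influence p ?A F i)"
      unfolding total_influence_eq[OF p] F_def ..
    then have k: "k = exp (10 ^ 12 * (real_of_int \<lceil>\<Sum>i\<in>?A. 2 * p * (1 - p) * influence p ?A F i\<rceil>)\<^sup>2
        * (\<delta> * \<epsilon>) powi (-2))"
      using assms(7) by (simp only:)
    show ?thesis
      unfolding *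
      unfolding k by (rule no_booster_bound) (use assms 3 mono in auto)
  qed
qed

end
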